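(* Let $(X,d)$ be a metric Polish space, $Y$ another Polish space, and $\mu$ a non-atomic Borel probability measure on $X$. Let $c:X\times Y\to\mathbb{R}$ be a bounded measurable coupling and $u:X\to Y$ a map such that $(x,z)\mapsto c(x,u(z))$ is upper semi-continuous. Consider the variational problems $$\mathrm{MK}_{\rm sym}(c):=\sup\Big\{\int_{X\times X}c(x,u(z))\,d\pi;\ \pi\in\Gamma_{sym}(\mu,\mu)\Big\},$$ $$\mathrm{DK}_{\rm sym}(c):=\inf\Big\{\int_XL(x,u(x))\,d\mu;\ L\in\mathcal{L}\Big\}.$$ Then: 1. $\mathrm{MK}_{\rm sym}(c)=\mathrm{DK}_{\rm sym}(c)$ and both of them are attained. 2. If $\pi_0\in\Gamma_{sym}(\mu,\mu)$ is a transport plan where $\mathrm{MK}_{\rm sym}(c)$ is attained, and $L$ is a $C$-selfdual Lagrangian where $\mathrm{DK}_{\rm sym}(c)$ is attained, then $$u(x)\in\partial_2^cH_L(x,z)\qquad\text{for }\pi_0\text{-a.e. }(x,z)\in X\times X.$$ Moreover, if $\pi_0$ is supported on the graph of a map $S$, then for $\mu$-almost all $x\in X$ we have $S^2x=x$, $H_L(x,Sx)=-H_L(Sx,x)$ and $u(x)\in\partial_2^cH_L(x,Sx)$. 3. If $u$ is $c$-monotone, then there exists a $C$-selfdual function $L$ such that $H_L(x,x)=0$ for $\mu$-a.e. $x\in X$, and $u(x)\in\partial_2^cH_L(x,x)$ for $\mu$-a.e. $x\in X$.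
   Context: $\Gamma_{sym}(\mu,\mu)$ is the set of Radon probability measures on $X\times X$ with both marginals equal to $\mu$ and invariant under $R(x,z)=(z,x)$. The symmetrized coupling $C:(X\times Y)\times(Y\times X)\to\mathbb{R}$ is $C((x_1,y_1),(y_2,x_2))=c(x_1,y_2)+c(x_2,y_1)$. For $L:X\times Y\to\mathbb{R}\cup\{+\infty\}$, $L^C(y,x)=\sup\{C((x_1,y_1),(y,x))-L(x_1,y_1);\ (x_1,y_1)\in X\times Y\}$; $L$ is $C$-selfdual (a $C$-selfdual Lagrangian) if $L^C(y,x)=L(x,y)$ for all $(x,y)\in X\times Y$. $\mathcal{L}$ is the class of all $C$-selfdual functions $L:X\times Y\to\mathbb{R}\cup\{+\infty\}$. The Hamiltonian of $L$ is $H_L(z,x)=\sup\{c(x,y)-L(z,y);\ y\in Y\}$ on $X\times X$. $\partial_2^cH_L(x,z)=\{y\in Y;\ H_L(x,z)-H_L(x,z')\le c(z,y)-c(z',y)\ \forall z'\in X\}$ is the $c$-subdifferential of $H_L(x,\cdot)$ at $z$. $u$ is $c$-monotone if $c(x,u(z))+c(z,u(x))\le c(x,u(x))+c(z,u(z))$ for all $x,z\in X$. *)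

theory Defs
  imports "HOL-Probability.Probability"
begin

definition nonatomic :: "'a measure \<Rightarrow> bool" where
  "nonatomic M \<longleftrightarrow>
     \<not> (\<exists>A\<in>sets M. emeasure M A > 0 \<and>
           (\<forall>B\<in>sets M. B \<subseteq> A \<longrightarrow> emeasure M B = 0 \<or> emeasure M (A - B) = 0))"

definition radon_prob :: "'a::topological_space measure \<Rightarrow> bool" where
  "radon_prob M \<longleftrightarrow> sets M = sets borel \<and> prob_space M \<and>
     (\<forall>A\<in>sets M. emeasure M A = (SUP K\<in>{K. K \<subseteq> A \<and> compact K \<and> K \<in> sets M}. emeasure M K))"

definition usc :: "('a::topological_space \<Rightarrow> real) \<Rightarrow> bool" where
  "usc f \<longleftrightarrow> (\<forall>a. open {x. f x < a})"

definition Gamma_sym :: "'x::topological_space measure \<Rightarrow> ('x \<times> 'x) measure set" where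
  "Gamma_sym \<mu> = {\<pi>. radon_prob \<pi> \<and> distr \<pi> borel fst = \<mu> \<and> distr \<pi> borel snd = \<mu> \<and>
                      distr \<pi> borel (\<lambda>(x, z). (z, x)) = \<pi>}"

definition sym_coupling :: "('x \<times> 'y \<Rightarrow> real) \<Rightarrow> ('x \<times> 'y) \<times> ('y \<times> 'x) \<Rightarrow> real" where
  "sym_coupling c = (\<lambda>((x\<^sub>1, y\<^sub>1), (y\<^sub>2, x\<^sub>2)). c (x\<^sub>1, y\<^sub>2) + c (x\<^sub>2, y\<^sub>1))"

definition C_conj :: "('x \<times> 'y \<Rightarrow> real) \<Rightarrow> ('x \<times> 'y \<Rightarrow> ereal) \<Rightarrow> 'y \<times> 'x \<Rightarrow> ereal" where
  "C_conj c L = (\<lambda>(y, x). SUP (x\<^sub>1, y\<^sub>1). ereal (sym_coupling c ((x\<^sub>1, y\<^sub>1), (y, x))) - L (x\<^sub>1, y\<^sub>1))"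

definition C_selfdual :: "('x \<times> 'y \<Rightarrow> real) \<Rightarrow> ('x \<times> 'y \<Rightarrow> ereal) set" where
  "C_selfdual c = {L. (\<forall>p. L p \<noteq> -\<infinity>) \<and> (\<forall>x y. C_conj c L (y, x) = L (x, y))}"

text \<open>When c is bounded, every C-selfdual L is bounded and hence so is its Hamiltonian, so that the
  extended-real subtraction in the c-subdifferential below is then always between finite values.\<close>

definition hamiltonian :: "('x \<times> 'y \<Rightarrow> real) \<Rightarrow> ('x \<times> 'y \<Rightarrow> ereal) \<Rightarrow> 'x \<times> 'x \<Rightarrow> ereal" where
  "hamiltonian c L = (\<lambda>(z, x). SUP y. ereal (c (x, y)) - L (z, y))"

definition c_subdiff2 :: "('x \<times> 'y \<Rightarrow> real) \<Rightarrow> ('x \<times> 'x \<Rightarrow> ereal) \<Rightarrow> 'x \<Rightarrow> 'x \<Rightarrow> 'y set" where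
  "c_subdiff2 c H x z = {y. \<forall>z'. H (x, z) - H (x, z') \<le> ereal (c (z, y) - c (z', y))}"

definition c_monotone :: "('x \<times> 'y \<Rightarrow> real) \<Rightarrow> ('x \<Rightarrow> 'y) \<Rightarrow> bool" where
  "c_monotone c u \<longleftrightarrow> (\<forall>x z. c (x, u z) + c (z, u x) \<le> c (x, u x) + c (z, u z))"

text \<open>A C-selfdual L is a supremum over an uncountable family, and u is an arbitrary map, so
  x \<open>\<mapsto>\<close> L(x, u(x)) need not be measurable. Its integral is therefore read as an upper integral,
  which for a measurable integrand bounded below is the usual integral, possibly infinite.\<close>

definition upper_integral :: "'a measure \<Rightarrow> ('a \<Rightarrow> ereal) \<Rightarrow> ereal" where
  "upper_integral M f = (INF h\<in>{h. integrable M h \<and> (AE x in M. f x \<le> ereal (h x))}.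
                           ereal (\<integral>x. h x \<partial>M))"

lemma upper_integral_integrable:
  fixes f :: "'a \<Rightarrow> real"
  assumes "integrable M f"
  shows "upper_integral M (\<lambda>x. ereal (f x)) = ereal (\<integral>x. f x \<partial>M)"
  unfolding upper_integral_def
proof (rule antisym)
  show "(INF h\<in>{h. integrable M h \<and> (AE x in M. ereal (f x) \<le> ereal (h x))}. ereal (\<integral>x. h x \<partial>M))
          \<le> ereal (\<integral>x. f x \<partial>M)"
    by (rule INF_lower) (use assms in simp)
  show "ereal (\<integral>x. f x \<partial>M) \<le>
      (INF h\<in>{h. integrable M h \<and> (AE x in M. ereal (f x) \<le> ereal (h x))}. ereal (\<integral>x. h x \<partial>M))"
    by (rule INF_greatest) (use assms in \<open>auto intro: integral_mono_AE\<close>)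
qed

lemma upper_integral_nonneg_measurable:
  assumes "f \<in> borel_measurable M" and "\<And>x. 0 \<le> f x"
  shows "upper_integral M f = enn2ereal (\<integral>\<^sup>+x. e2ennreal (f x) \<partial>M)"
proof (cases "(\<integral>\<^sup>+x. e2ennreal (f x) \<partial>M) = \<infinity>")
  case True
  have "\<not> (integrable M h \<and> (AE x in M. f x \<le> ereal (h x)))" for h
  proof
    assume h: "integrable M h \<and> (AE x in M. f x \<le> ereal (h x))"
    have "(\<integral>\<^sup>+x. e2ennreal (f x) \<partial>M) \<le> (\<integral>\<^sup>+x. ennreal (norm (h x)) \<partial>M)"
    proof (rule nn_integral_mono_AE)
      from h have "AE x in M. f x \<le> ereal (h x)" by simp
      then show "AE x in M. e2ennreal (f x) \<le> ennreal (norm (h x))"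
      proof eventually_elim
        case (elim x)
        then have "f x \<le> ereal (norm (h x))" by (rule order_trans) simp
        then have "e2ennreal (f x) \<le> e2ennreal (ereal (norm (h x)))" by (rule e2ennreal_mono)
        then show ?case by (simp only: e2ennreal_ereal)
      qed
    qed
    with h True show False
      by (auto simp: integrable_iff_bounded top_unique)
  qed
  then have "{h. integrable M h \<and> (AE x in M. f x \<le> ereal (h x))} = {}" by blast
  then have "upper_integral M f = \<infinity>"
    by (simp only: upper_integral_def image_empty Inf_empty top_ereal_def)
  then show ?thesis using True by simp
next
  case False
  have m: "(\<lambda>x. e2ennreal (f x)) \<in> borel_measurable M" using assms(1) by simp
  have ae: "AE x in M. e2ennreal (f x) \<noteq> \<infinity>"
    using nn_integral_PInf_AE[OF m] False by simp
  define g where "g = (\<lambda>x. real_of_ereal (f x))"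
  have gm: "g \<in> borel_measurable M" unfolding g_def using assms(1) by simp
  have g0: "0 \<le> g x" for x unfolding g_def using assms(2) by (simp add: real_of_ereal_pos)
  have fg: "AE x in M. f x = ereal (g x)"
    using ae
  proof eventually_elim
    case (elim x)
    then show ?case using assms(2)[of x] unfolding g_def by (cases "f x") auto
  qed
  have nn: "(\<integral>\<^sup>+x. e2ennreal (f x) \<partial>M) = (\<integral>\<^sup>+x. ennreal (g x) \<partial>M)"
  proof (rule nn_integral_cong_AE)
    from fg show "AE x in M. e2ennreal (f x) = ennreal (g x)"
      by eventually_elim (simp only: e2ennreal_ereal)
  qed
  have gi: "integrable M g"
    using gm g0 False nn by (auto simp: integrable_iff_bounded less_top[symmetric] abs_of_nonneg)
  have "upper_integral M f = upper_integral M (\<lambda>x. ereal (g x))"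
  proof -
    have "(AE x in M. f x \<le> ereal (h x)) \<longleftrightarrow> (AE x in M. ereal (g x) \<le> ereal (h x))" for h
    proof (rule eventually_cong[OF fg])
      fix x assume "f x = ereal (g x)"
      then show "(f x \<le> ereal (h x)) = (ereal (g x) \<le> ereal (h x))" by simp
    qed
    then show ?thesis by (simp add: upper_integral_def)
  qed
  also have "\<dots> = ereal (\<integral>x. g x \<partial>M)" by (rule upper_integral_integrable[OF gi])
  also have "\<dots> = enn2ereal (\<integral>\<^sup>+x. ennreal (g x) \<partial>M)"
    using nn_integral_eq_integral[OF gi] g0 by (simp add: enn2ereal_ennreal integral_nonneg_AE)
  finally show ?thesis using nn by simp
qed

definition MK_sym :: "'x::topological_space measure \<Rightarrow> ('x \<times> 'y \<Rightarrow> real) \<Rightarrow> ('x \<Rightarrow> 'y) \<Rightarrow> ereal" where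
  "MK_sym \<mu> c u = (SUP \<pi>\<in>Gamma_sym \<mu>. ereal (\<integral>(x, z). c (x, u z) \<partial>\<pi>))"

definition DK_sym :: "'x measure \<Rightarrow> ('x \<times> 'y \<Rightarrow> real) \<Rightarrow> ('x \<Rightarrow> 'y) \<Rightarrow> ereal" where
  "DK_sym \<mu> c u = (INF L\<in>C_selfdual c. upper_integral \<mu> (\<lambda>x. L (x, u x)))"

end

theory Submission
  imports Defs
begin

text \<open>
  Write \<open>f(x,z) = c(x, u z)\<close>. For a selfdual \<open>L\<close> the function \<open>\<phi>(x) = L(x, u x)\<close> satisfies
  \<open>\<phi>(x) + \<phi>(z) \<ge> f(x,z) + f(z,x)\<close>, and conversely every bounded \<open>\<phi>\<close> with this property dominates
  \<open>x \<mapsto> L(x, u x)\<close> for some selfdual \<open>L\<close>: by Zorn's lemma there is a minimal \<open>L\<close> with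
  \<open>L(p) + L(q) \<ge> C(p,q)\<close> below the extension of \<open>\<phi>\<close>, and minimality forces \<open>L\<^sup>C = L\<close>. So the dual
  problem is the symmetric Kantorovich dual. Its value is a sublinear functional of the bounded cost;
  a Hahn-Banach functional touching it at \<open>f\<close> is a finitely additive symmetric coupling of \<open>\<mu>\<close> with
  itself, countably additive on the algebra of rectangles because its marginals are Radon (Marczewski and
  Ryll-Nardzewski), and its countably additive extension can only increase the integral of the upper
  semicontinuous \<open>f\<close>. A dual optimizer is the almost everywhere limit of a minimizing sequence that is
  Cauchy in \<open>L\<^sup>2\<close>. The statements on \<open>H\<^sub>L\<close> follow from equality in
  \<open>L(x, u x) + L(z, u z) \<ge> c(x, u z) + c(z, u x)\<close>, which holds almost everywhere for optimizers, and
  everywhere on the diagonal when \<open>u\<close> is \<open>c\<close>-monotone.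
\<close>

section \<open>Minimal functions and sublinear functionals\<close>

lemma le_cINF_add:
  fixes f :: "'a \<Rightarrow> real" and g :: "'b \<Rightarrow> real"
  assumes "A \<noteq> {}" "B \<noteq> {}" and le: "\<And>a b. a \<in> A \<Longrightarrow> b \<in> B \<Longrightarrow> x \<le> f a + g b"
  shows "x \<le> (INF a\<in>A. f a) + (INF b\<in>B. g b)"
proof -
  have "x - (INF a\<in>A. f a) \<le> (INF b\<in>B. g b)"
  proof (rule cINF_greatest[OF assms(2)])
    fix b assume "b \<in> B"
    have "x - g b \<le> (INF a\<in>A. f a)"
      by (rule cINF_greatest[OF assms(1)]) (use le[OF _ \<open>b \<in> B\<close>] in \<open>simp add: algebra_simps\<close>)
    then show "x - (INF a\<in>A. f a) \<le> g b" by simp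
  qed
  then show ?thesis by simp
qed

text \<open>Zorn's lemma for the reversed pointwise order, used both for Lagrangians and for
  Hahn-Banach. The floor \<open>m\<close> makes the pointwise infimum of a nonempty chain a true
  lower bound, and minimality below \<open>N\<close> is minimality in \<open>A\<close> because
  everything below \<open>l\<close> is also below \<open>N\<close>.\<close>

lemma minimal_function_exists:
  fixes A :: "('a \<Rightarrow> real) set"
  assumes N: "N \<in> A"
    and bd: "\<And>a x. a \<in> A \<Longrightarrow> m x \<le> a x"
    and chain: "\<And>K. K \<subseteq> A \<Longrightarrow> K \<noteq> {} \<Longrightarrow> (\<And>a b. a \<in> K \<Longrightarrow> b \<in> K \<Longrightarrow> a \<le> b \<or> b \<le> a)
        \<Longrightarrow> (\<lambda>x. INF a\<in>K. a x) \<in> A"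
  obtains l where "l \<in> A" "l \<le> N" "\<And>a. a \<in> A \<Longrightarrow> a \<le> l \<Longrightarrow> a = l"
proof -
  let ?A = "{a \<in> A. a \<le> N}"
  have "\<exists>l\<in>?A. \<forall>a\<in>?A. a \<le> l \<longrightarrow> a = l"
  proof (rule predicate_Zorn)
    show "partial_order_on ?A (relation_of (\<lambda>a b. b \<le> a) ?A)"
      by (rule partial_order_on_relation_ofI) auto
  next
    fix K assume K: "K \<in> Chains (relation_of (\<lambda>a b. b \<le> a) ?A)"
    then have sub: "K \<subseteq> ?A" and tot: "\<And>a b. a \<in> K \<Longrightarrow> b \<in> K \<Longrightarrow> a \<le> b \<or> b \<le> a"
      unfolding Chains_def relation_of_def by auto
    show "\<exists>u\<in>?A. \<forall>a\<in>K. u \<le> a"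
    proof (cases "K = {}")
      case True then show ?thesis using N by auto
    next
      case False
      let ?u = "\<lambda>x. INF a\<in>K. a x"
      have low: "?u \<le> a" if "a \<in> K" for a
      proof (rule le_funI)
        fix x
        have "bdd_below ((\<lambda>a. a x) ` K)" using sub bd by (intro bdd_belowI2[of K "m x"]) auto
        then show "?u x \<le> a x" using that by (rule cINF_lower)
      qed
      have "?u \<in> A" using sub by (intro chain False tot) auto
      moreover have "?u \<le> N"
      proof -
        obtain a where a: "a \<in> K" using False by blast
        then have "a \<le> N" using sub by blast
        with low[OF a] show ?thesis by (rule order_trans)
      qed
      ultimately show ?thesis using low by (intro bexI[of _ ?u] ballI) simp_all
    qed
  qed
  then show ?thesis using that by force
qed

text \<open>The constraint says that \<open>l\<close> lies above its own conjugate. Where a minimal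
  \<open>l\<close> lay strictly above it, \<open>l\<close> could be lowered at that single point
  without violating the constraint.\<close>

lemma minimal_self_conjugate:
  fixes C :: "'p \<Rightarrow> 'p \<Rightarrow> real"
  assumes sym: "\<And>p q. C p q = C q p" and N: "\<And>p q. C p q \<le> N p + N q"
  obtains l where "\<And>p. l p \<le> N p" "\<And>p q. C p q \<le> l p + l q"
    "\<And>p. (SUP q. ereal (C q p) - ereal (l q)) = ereal (l p)"
proof -
  let ?A = "{l. \<forall>p q. C p q \<le> l p + l q}"
  obtain l where l: "l \<in> ?A" and lN: "l \<le> N" and min: "\<And>a. a \<in> ?A \<Longrightarrow> a \<le> l \<Longrightarrow> a = l"
  proof (rule minimal_function_exists[of N ?A "\<lambda>p. C p p / 2"])
    show "N \<in> ?A" using N by auto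
    show bd: "C p p / 2 \<le> a p" if "a \<in> ?A" for a p
      using that by (auto dest!: spec[of _ p])
    fix K assume K: "K \<subseteq> ?A" "K \<noteq> {}" and tot: "\<And>a b. a \<in> K \<Longrightarrow> b \<in> K \<Longrightarrow> a \<le> b \<or> b \<le> a"
    have "C p q \<le> (INF a\<in>K. a p) + (INF a\<in>K. a q)" for p q
    proof -
      \<comment> \<open>Two members of the chain are comparable, so the mixed sum dominates the sum
        for the smaller of the two, which satisfies the constraint.\<close>
      have ab: "C p q \<le> a p + b q" if "a \<in> K" "b \<in> K" for a b
      proof (cases "a \<le> b")
        case True
        then have "a q \<le> b q" by (simp add: le_fun_def)
        with K that show ?thesis by (smt (verit) mem_Collect_eq subsetD)
      next
        case False
        then have "b p \<le> a p" using tot[OF that] by (auto simp: le_fun_def)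
        with K that show ?thesis by (smt (verit) mem_Collect_eq subsetD)
      qed
      then show ?thesis by (intro le_cINF_add K(2))
    qed
    then show "(\<lambda>x. INF a\<in>K. a x) \<in> ?A" by simp
  qed blast
  have le: "C p q \<le> l p + l q" for p q using l by auto
  have "(SUP q. ereal (C q p) - ereal (l q)) = ereal (l p)" for p
  proof (rule antisym)
    show "(SUP q. ereal (C q p) - ereal (l q)) \<le> ereal (l p)"
      by (rule SUP_least) (use le in \<open>simp add: algebra_simps\<close>)
    show "ereal (l p) \<le> (SUP q. ereal (C q p) - ereal (l q))"
    proof (rule ccontr)
      assume "\<not> ?thesis"
      then have "(SUP q. ereal (C q p) - ereal (l q)) < ereal (l p)" by (rule not_le_imp_less)
      from ereal_dense2[OF this] obtain s
        where s: "(SUP q. ereal (C q p) - ereal (l q)) < ereal s" "ereal s < ereal (l p)" by blast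
      have sq: "C p q - l q \<le> s" for q
      proof -
        have "ereal (C q p) - ereal (l q) \<le> (SUP q. ereal (C q p) - ereal (l q))"
          by (rule SUP_upper) simp
        then have "ereal (C q p) - ereal (l q) < ereal s" using s(1) by (rule le_less_trans)
        then show ?thesis using sym[of p q] by simp
      qed
      \<comment> \<open>Lowering \<open>l\<close> to \<open>v\<close> at the single point \<open>p\<close> contradicts minimality.\<close>
      define v where "v = max s (C p p / 2)"
      \<comment> \<open>The term \<open>C p p / 2\<close> is there because the lowered value counts
        twice at \<open>(p, p)\<close>. It is below \<open>l p\<close>, since \<open>sq\<close> at
        \<open>p\<close> gives \<open>C p p - l p \<le> s\<close> and
        \<open>s < l p\<close>.\<close>
      have v: "v < l p" using sq[of p] s(2) by (simp add: v_def)
      have vq: "C p q \<le> v + l q" for q using sq[of q] by (simp add: v_def)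
      have vp: "C p p \<le> v + v" by (simp add: v_def)
      have "C a b \<le> (l(p := v)) a + (l(p := v)) b" for a b
        using le[of a b] vq[of b] vq[of a] vp sym[of a p] by (cases "a = p"; cases "b = p") auto
      then have "l(p := v) \<in> ?A" by blast
      moreover have "l(p := v) \<le> l" using v by (auto simp: le_fun_def)
      ultimately have "l(p := v) = l" by (rule min)
      then have "(l(p := v)) p = l p" by (rule fun_cong)
      with v show False by simp
    qed
  qed
  with le lN show ?thesis by (intro that[of l]) (auto simp: le_fun_def)
qed

section \<open>Hahn-Banach through minimal sublinear functionals\<close>

definition sublinear_on :: "('a \<Rightarrow> real) set \<Rightarrow> (('a \<Rightarrow> real) \<Rightarrow> real) \<Rightarrow> bool" where
  "sublinear_on S q \<longleftrightarrow> (\<forall>F\<in>S. \<forall>G\<in>S. q (\<lambda>x. F x + G x) \<le> q F + q G) \<and>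
     (\<forall>F\<in>S. \<forall>t>0. q (\<lambda>x. t * F x) = t * q F)"

lemma sublinear_onD:
  assumes "sublinear_on S q" "F \<in> S"
  shows "G \<in> S \<Longrightarrow> q (\<lambda>x. F x + G x) \<le> q F + q G"
    and "t > 0 \<Longrightarrow> q (\<lambda>x. t * F x) = t * q F"
  using assms by (simp_all add: sublinear_on_def)

locale function_subspace =
  fixes S :: "('a \<Rightarrow> real) set"
  assumes zero: "(\<lambda>_. 0) \<in> S"
    and add: "\<And>F G. F \<in> S \<Longrightarrow> G \<in> S \<Longrightarrow> (\<lambda>x. F x + G x) \<in> S"
    and scale: "\<And>F t. F \<in> S \<Longrightarrow> (\<lambda>x. t * F x) \<in> S"
begin

lemma minus: "F \<in> S \<Longrightarrow> (\<lambda>x. - F x) \<in> S"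
  using scale[of F "-1"] by simp

lemma sublinear_zero: "sublinear_on S q \<Longrightarrow> q (\<lambda>_. 0) = 0"
  using zero unfolding sublinear_on_def by (auto dest!: bspec[of _ _ "\<lambda>_. 0"] spec[of _ "2::real"])

lemma sublinear_minus: "sublinear_on S q \<Longrightarrow> F \<in> S \<Longrightarrow> - q (\<lambda>x. - F x) \<le> q F"
proof -
  assume q: "sublinear_on S q" and F: "F \<in> S"
  have "q (\<lambda>x. F x + - F x) \<le> q F + q (\<lambda>x. - F x)"
    by (rule sublinear_onD(1)[OF q F minus[OF F]])
  then show ?thesis using sublinear_zero[OF q] by simp
qed

lemma sublinear_scale0: "sublinear_on S q \<Longrightarrow> F \<in> S \<Longrightarrow> 0 \<le> t \<Longrightarrow> q (\<lambda>x. t * F x) = t * q F"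
  using sublinear_zero[of q] unfolding sublinear_on_def by (cases "t = 0") auto

text \<open>The three properties together make \<open>r\<close> odd at \<open>v\<close> with
  \<open>r v = q v\<close>. A minimal \<open>q\<close> cannot be lowered to a different
  \<open>r\<close>, so it must itself be odd at every \<open>v\<close>.\<close>

lemma sublinear_reduce:
  assumes q: "sublinear_on S q" and v: "v \<in> S"
  obtains r where "sublinear_on S r" "\<And>F. F \<in> S \<Longrightarrow> r F \<le> q F" "r (\<lambda>x. - v x) \<le> - q v"
proof -
  \<comment> \<open>The parameter \<open>t = 0\<close> gives \<open>r \<le> q\<close>, and
    \<open>t = 1\<close> at \<open>- v\<close> gives the last claim. The infimum is finite because
    subadditivity yields \<open>q (t * v) \<le> q (- F) + q (F + t * v)\<close>.\<close>
  define r where "r F = (INF t\<in>{0..}. q (\<lambda>x. F x + t * v x) - t * q v)" for F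
  have qa: "q (\<lambda>x. F x + G x) \<le> q F + q G" if "F \<in> S" "G \<in> S" for F G
    using sublinear_onD(1)[OF q that] .
  have lower: "- q (\<lambda>x. - F x) \<le> q (\<lambda>x. F x + t * v x) - t * q v" if F: "F \<in> S" and "t \<in> {0..}" for F t
    using qa[OF minus[OF F] add[OF F scale[OF v, of t]]] sublinear_scale0[OF q v, of t] that by simp
  have bdd: "bdd_below ((\<lambda>t. q (\<lambda>x. F x + t * v x) - t * q v) ` {0..})" if "F \<in> S" for F
    using lower[OF that] by (rule bdd_belowI2)
  have le: "r F \<le> q (\<lambda>x. F x + t * v x) - t * q v" if "F \<in> S" "0 \<le> t" for F t
    unfolding r_def using that by (intro cINF_lower bdd) auto
  \<comment> \<open>One inequality suffices: applied to \<open>inverse s\<close> and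
    \<open>s * F\<close> it yields the reverse one.\<close>
  have hom: "r (\<lambda>x. s * F x) \<le> s * r F" if F: "F \<in> S" and s: "s > 0" for s F
  proof -
    have "r (\<lambda>x. s * F x) / s \<le> r F" unfolding r_def[of F]
    proof (rule cINF_greatest)
      fix t :: real assume t: "t \<in> {0..}"
      have "r (\<lambda>x. s * F x) \<le> q (\<lambda>x. s * F x + (s * t) * v x) - (s * t) * q v"
        using t s by (intro le scale F) auto
      also have "(\<lambda>x. s * F x + (s * t) * v x) = (\<lambda>x. s * (F x + t * v x))"
        by (simp add: algebra_simps)
      also have "q \<dots> = s * q (\<lambda>x. F x + t * v x)"
        using s by (intro sublinear_scale0 q add F scale v) auto
      finally show "r (\<lambda>x. s * F x) / s \<le> q (\<lambda>x. F x + t * v x) - t * q v"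
        using s by (simp add: field_simps)
    qed simp
    then show ?thesis using s by (simp add: field_simps)
  qed
  have "sublinear_on S r"
    unfolding sublinear_on_def
  proof (intro conjI ballI allI impI)
    fix F and s :: real assume F: "F \<in> S" and s: "s > 0"
    have "r (\<lambda>x. inverse s * (s * F x)) \<le> inverse s * r (\<lambda>x. s * F x)"
      using s by (intro hom scale F) auto
    then have "s * r F \<le> r (\<lambda>x. s * F x)" using s by (simp add: field_simps)
    with hom[OF F s] show "r (\<lambda>x. s * F x) = s * r F" by simp
  next
    fix F G assume F: "F \<in> S" and G: "G \<in> S"
    have st: "r (\<lambda>x. F x + G x) \<le> (q (\<lambda>x. F x + s * v x) - s * q v) + (q (\<lambda>x. G x + t * v x) - t * q v)"
      if "0 \<le> s" "0 \<le> t" for s t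
    proof -
      have "r (\<lambda>x. F x + G x) \<le> q (\<lambda>x. (F x + G x) + (s + t) * v x) - (s + t) * q v"
        using that by (intro le add F G) auto
      also have "(\<lambda>x. (F x + G x) + (s + t) * v x) = (\<lambda>x. (F x + s * v x) + (G x + t * v x))"
        by (simp add: algebra_simps)
      also have "q \<dots> \<le> q (\<lambda>x. F x + s * v x) + q (\<lambda>x. G x + t * v x)"
        by (intro qa add scale F G v)
      finally show ?thesis by (simp add: algebra_simps)
    qed
    show "r (\<lambda>x. F x + G x) \<le> r F + r G"
      unfolding r_def[of F] r_def[of G] by (intro le_cINF_add st) auto
  qed
  moreover have "r F \<le> q F" if "F \<in> S" for F using le[OF that, of 0] by simp
  moreover have "r (\<lambda>x. - v x) \<le> - q v"
    using le[OF minus[OF v], of 1] sublinear_zero[OF q] by simp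
  ultimately show ?thesis by (rule that)
qed

text \<open>First \<open>p\<close> is reduced at \<open>f\<close>, then a minimal sublinear
  functional below the result is taken. By \<open>sublinear_reduce\<close> it is odd on
  \<open>S\<close>, and an odd sublinear functional is linear.\<close>

lemma hahn_banach:
  assumes p: "sublinear_on S p" and f: "f \<in> S"
  obtains \<Lambda> where "\<And>F G. F \<in> S \<Longrightarrow> G \<in> S \<Longrightarrow> \<Lambda> (\<lambda>x. F x + G x) = \<Lambda> F + \<Lambda> G"
    "\<And>F t. F \<in> S \<Longrightarrow> \<Lambda> (\<lambda>x. t * F x) = t * \<Lambda> F"
    "\<And>F. F \<in> S \<Longrightarrow> \<Lambda> F \<le> p F" "\<Lambda> f = p f"
proof -
  obtain p' where p': "sublinear_on S p'" "\<And>F. F \<in> S \<Longrightarrow> p' F \<le> p F" "p' (\<lambda>x. - f x) \<le> - p f"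
    by (rule sublinear_reduce[OF p f]) (rule that)
  \<comment> \<open>Functionals are total functions, so their values outside \<open>S\<close> are
    pinned to 0; otherwise the pointwise order would have no floor there.\<close>
  let ?A = "{q. sublinear_on S q \<and> (\<forall>F\<in>S. q F \<le> p' F) \<and> (\<forall>F. F \<notin> S \<longrightarrow> q F = 0)}"
  let ?N = "\<lambda>F. if F \<in> S then p' F else 0"
  have cut: "(\<lambda>F. if F \<in> S then q F else 0) \<in> ?A"
    if "sublinear_on S q" "\<And>F. F \<in> S \<Longrightarrow> q F \<le> p' F" for q
    using that(2) sublinear_onD[OF that(1)] by (simp add: sublinear_on_def add scale)
  have bd: "- p' (\<lambda>x. - F x) \<le> q F" if "q \<in> ?A" "F \<in> S" for q F
  proof -
    have "- p' (\<lambda>x. - F x) \<le> - q (\<lambda>x. - F x)" using that minus[OF that(2)] by simp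
    also have "\<dots> \<le> q F" using that by (intro sublinear_minus) simp_all
    finally show ?thesis .
  qed
  obtain q where q: "q \<in> ?A" and min: "\<And>a. a \<in> ?A \<Longrightarrow> a \<le> q \<Longrightarrow> a = q"
  proof (rule minimal_function_exists[of ?N ?A "\<lambda>F. if F \<in> S then - p' (\<lambda>x. - F x) else 0"])
    show "?N \<in> ?A" using p' by (intro cut) auto
    show "(if F \<in> S then - p' (\<lambda>x. - F x) else 0) \<le> a F" if "a \<in> ?A" for a F
    proof (cases "F \<in> S")
      case True then show ?thesis using bd[OF that True] by simp
    next
      case False then show ?thesis using that by simp
    qed
    fix K assume K: "K \<subseteq> ?A" "K \<noteq> {}" and tot: "\<And>a b. a \<in> K \<Longrightarrow> b \<in> K \<Longrightarrow> a \<le> b \<or> b \<le> a"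
    let ?u = "\<lambda>F. INF a\<in>K. a F"
    have bdd: "bdd_below ((\<lambda>a. a F) ` K)" if "F \<in> S" for F
    proof (rule bdd_belowI2)
      show "- p' (\<lambda>x. - F x) \<le> a F" if "a \<in> K" for a
        using that K(1) by (intro bd \<open>F \<in> S\<close>) auto
    qed
    have le: "?u F \<le> a F" if "F \<in> S" "a \<in> K" for F a
      using bdd[OF that(1)] that(2) by (rule cINF_lower)
    have aa: "a (\<lambda>x. F x + G x) \<le> a F + a G" if "a \<in> K" "F \<in> S" "G \<in> S" for a F G
      using that K(1) by (intro sublinear_onD(1)[of S]) auto
    have ah: "a (\<lambda>x. t * F x) = t * a F" if "a \<in> K" "F \<in> S" "t > 0" for a F t
      using that K(1) by (intro sublinear_onD(2)[of S]) auto
    have "sublinear_on S ?u" unfolding sublinear_on_def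
    proof (intro conjI ballI allI impI)
      fix F and t :: real assume F: "F \<in> S" and t: "t > 0"
      have "?u (\<lambda>x. t * F x) / t \<le> ?u F"
      proof (rule cINF_greatest[OF K(2)])
        fix a assume "a \<in> K"
        then show "?u (\<lambda>x. t * F x) / t \<le> a F"
          using le[OF scale[OF F, of t], of a] ah[OF _ F t, of a] t by (simp add: field_simps)
      qed
      moreover have "t * ?u F \<le> ?u (\<lambda>x. t * F x)"
      proof (rule cINF_greatest[OF K(2)])
        fix a assume "a \<in> K"
        then show "t * ?u F \<le> a (\<lambda>x. t * F x)"
          using le[OF F, of a] ah[OF _ F t, of a] t by simp
      qed
      ultimately show "?u (\<lambda>x. t * F x) = t * ?u F" using t by (simp add: field_simps)
    next
      fix F G assume F: "F \<in> S" and G: "G \<in> S"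
      have ab: "?u (\<lambda>x. F x + G x) \<le> a F + b G" if "a \<in> K" "b \<in> K" for a b
      proof (cases "a \<le> b")
        case True
        then have "a G \<le> b G" by (simp add: le_fun_def)
        with le[OF add[OF F G] that(1)] aa[OF that(1) F G] show ?thesis by simp
      next
        case False
        then have "b F \<le> a F" using tot[OF that] by (auto simp: le_fun_def)
        with le[OF add[OF F G] that(2)] aa[OF that(2) F G] show ?thesis by simp
      qed
      then show "?u (\<lambda>x. F x + G x) \<le> ?u F + ?u G" by (intro le_cINF_add K(2))
    qed
    moreover have "?u F \<le> p' F" if "F \<in> S" for F
    proof -
      obtain a where "a \<in> K" using K(2) by auto
      then have "a F \<le> p' F" using K(1) that by auto
      with le[OF that \<open>a \<in> K\<close>] show ?thesis by (rule order_trans)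
    qed
    moreover have "?u F = 0" if "F \<notin> S" for F
    proof -
      have "(\<lambda>a. a F) ` K = (\<lambda>a. 0) ` K" using K(1) that by (intro image_cong) auto
      then show ?thesis using K(2) by simp
    qed
    ultimately show "?u \<in> ?A" by auto
  qed blast
  have qs: "sublinear_on S q" using q by simp
  have odd: "q (\<lambda>x. - v x) = - q v" if v: "v \<in> S" for v
  proof -
    obtain r where r: "sublinear_on S r" "\<And>F. F \<in> S \<Longrightarrow> r F \<le> q F" "r (\<lambda>x. - v x) \<le> - q v"
      by (rule sublinear_reduce[OF qs v]) (rule that)
    have rp: "r F \<le> p' F" if "F \<in> S" for F
    proof -
      have "q F \<le> p' F" using q that by simp
      with r(2)[OF that] show ?thesis by (rule order_trans)
    qed
    have eq: "(\<lambda>F. if F \<in> S then r F else 0) = q"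
    proof (intro min cut r(1) rp le_funI)
      show "(if F \<in> S then r F else 0) \<le> q F" for F using r(2)[of F] q by auto
    qed
    have "q (\<lambda>x. - v x) = r (\<lambda>x. - v x)"
      using fun_cong[OF eq, of "\<lambda>x. - v x"] minus[OF v] by simp
    with r(3) sublinear_minus[OF qs v] show ?thesis by simp
  qed
  show ?thesis
  proof
    fix F G assume F: "F \<in> S" and G: "G \<in> S"
    \<comment> \<open>Subadditivity at \<open>- F\<close> and \<open>- G\<close>, read through
      oddness, is superadditivity at \<open>F\<close> and \<open>G\<close>.\<close>
    have "q (\<lambda>x. - F x + - G x) \<le> q (\<lambda>x. - F x) + q (\<lambda>x. - G x)"
      by (rule sublinear_onD(1)[OF qs minus[OF F] minus[OF G]])
    moreover have "q (\<lambda>x. F x + G x) \<le> q F + q G"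
      by (rule sublinear_onD(1)[OF qs F G])
    moreover have "(\<lambda>x. - F x + - G x) = (\<lambda>x. - (F x + G x))" by simp
    ultimately show "q (\<lambda>x. F x + G x) = q F + q G"
      using odd[OF F] odd[OF G] odd[OF add[OF F G]] by simp
  next
    fix F and t :: real assume F: "F \<in> S"
    show "q (\<lambda>x. t * F x) = t * q F"
    proof (cases "0 \<le> t")
      case True then show ?thesis by (rule sublinear_scale0[OF qs F])
    next
      case False
      then have "q (\<lambda>x. (- t) * F x) = - t * q F" by (intro sublinear_scale0[OF qs F]) auto
      with odd[OF scale[OF F, of "t"]] show ?thesis by simp
    qed
  next
    show le: "q F \<le> p F" if "F \<in> S" for F
    proof -
      have "q F \<le> p' F" using q that by simp
      also have "p' F \<le> p F" by (rule p'(2)[OF that])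
      finally show ?thesis .
    qed
    \<comment> \<open>The preliminary reduction at \<open>f\<close> enters here:
      \<open>- q f = q (- f) \<le> p' (- f) \<le> - p f\<close>.\<close>
    have "q (\<lambda>x. - f x) \<le> p' (\<lambda>x. - f x)" using q minus[OF f] by simp
    then have "- q f \<le> p' (\<lambda>x. - f x)" using odd[OF f] by simp
    with p'(3) le[OF f] show "q f = p f" by simp
  qed
qed

end

section \<open>Extension of finitely additive couplings\<close>

lemma compact_inner_approx:
  fixes M :: "'a::{second_countable_topology, complete_space} measure"
  assumes M: "sets M = sets borel" "finite_measure M" and A: "A \<in> sets borel" and e: "0 < e"
  obtains K where "compact K" "K \<subseteq> A" "measure M (A - K) < e"
proof -
  interpret finite_measure M by fact
  have "\<exists>K\<in>{K. K \<subseteq> A \<and> compact K}. emeasure M A < emeasure M K + ennreal e"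
  proof (rule SUP_approx_ennreal[OF e])
    show "{K. K \<subseteq> A \<and> compact K} \<noteq> {}" using compact_empty by blast
    show "emeasure M A = (SUP K \<in> {K. K \<subseteq> A \<and> compact K}. emeasure M K)"
      using M(1) A by (intro inner_regular) auto
  qed simp
  then obtain K where K: "K \<subseteq> A" "compact K" and lt: "emeasure M A < emeasure M K + ennreal e"
    by blast
  have "measure M (A - K) = measure M A - measure M K"
    using A K M(1) by (intro finite_measure_Diff) (auto simp: borel_compact)
  also have "\<dots> < e"
    using lt e by (simp add: emeasure_eq_measure ennreal_plus[symmetric] ennreal_less_iff del: ennreal_plus)
  finally show ?thesis using K that by blast
qed

lemma open_prod_eq_UN_rectangles:
  fixes U :: "('a::second_countable_topology \<times> 'b::second_countable_topology) set"
  assumes "open U"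
  obtains A B where "\<And>i::nat. open (A i)" "\<And>i. open (B i)" "U = (\<Union>i. A i \<times> B i)"
proof -
  let ?F = "{V. V \<subseteq> U \<and> (\<exists>A B. open A \<and> open B \<and> V = A \<times> B)}"
  have "open V" if "V \<in> ?F" for V using that open_Times by blast
  from Lindelof[of ?F, OF this] obtain F where F: "F \<subseteq> ?F" "countable F" "\<Union>F = \<Union>?F" .
  have "\<Union>?F = U"
  proof (rule antisym)
    show "U \<subseteq> \<Union>?F"
    proof
      fix x assume "x \<in> U"
      from open_prod_elim[OF assms this] obtain A B
        where "open A" "open B" "x \<in> A \<times> B" "A \<times> B \<subseteq> U" .
      then show "x \<in> \<Union>?F" by blast
    qed
  qed blast
  \<comment> \<open>The empty rectangle is added so that the family is nonempty and can be
    enumerated by the naturals even when \<open>U\<close> is empty.\<close>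
  moreover define R where "R = from_nat_into (insert ({} \<times> {}) F)"
  have rng: "range R = insert ({} \<times> {}) F"
    unfolding R_def using F(2) by (intro range_from_nat_into) auto
  ultimately have U: "U = (\<Union>i. R i)" using F(3) by (auto simp: rng)
  have "\<exists>A B. open A \<and> open B \<and> R i = A \<times> B" for i
  proof -
    have "R i \<in> insert ({} \<times> {}) F" using rng by blast
    with F(1) open_empty show ?thesis by blast
  qed
  then obtain A B where "\<And>i. open (A i)" "\<And>i. open (B i)" "\<And>i. R i = A i \<times> B i" by metis
  with U show ?thesis by (intro that[of A B]) auto
qed

text \<open>Tightness of the two marginals passes to rectangles: the part of
  \<open>A \<times> B\<close> outside \<open>K \<times> L\<close> is covered by two strips, each
  controlled by one marginal. Compact approximation then gives continuity at the empty set, and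
  Caratheodory's theorem applies. A closed set is a decreasing intersection of complements of finite
  unions of open rectangles. On these complements the extension agrees with \<open>\<rho>\<close>;
  in the limit only an inequality survives, as \<open>\<rho>\<close> itself need not be continuous
  from above.\<close>

lemma finitely_additive_extension:
  fixes \<rho> :: "('a::{second_countable_topology, complete_space} \<times>
      'b::{second_countable_topology, complete_space}) set \<Rightarrow> real"
  assumes \<mu>: "sets \<mu> = sets borel" "finite_measure \<mu>" and \<nu>: "sets \<nu> = sets borel" "finite_measure \<nu>"
    and nonneg: "\<And>E. 0 \<le> \<rho> E" and add: "\<And>E F. E \<inter> F = {} \<Longrightarrow> \<rho> (E \<union> F) = \<rho> E + \<rho> F"
    and fst: "\<And>A. A \<in> sets borel \<Longrightarrow> \<rho> (A \<times> UNIV) = measure \<mu> A"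
    and snd: "\<And>B. B \<in> sets borel \<Longrightarrow> \<rho> (UNIV \<times> B) = measure \<nu> B"
  obtains \<pi> where "sets \<pi> = sets borel"
    "\<And>A B. A \<in> sets borel \<Longrightarrow> B \<in> sets borel \<Longrightarrow> emeasure \<pi> (A \<times> B) = ennreal (\<rho> (A \<times> B))"
    "\<And>C. closed C \<Longrightarrow> ennreal (\<rho> C) \<le> emeasure \<pi> C"
proof -
  have mono: "\<rho> E \<le> \<rho> F" if "E \<subseteq> F" for E F
    using add[of E "F - E"] nonneg[of "F - E"] that by (simp add: Un_absorb1)
  have subadd: "\<rho> (E \<union> F) \<le> \<rho> E + \<rho> F" for E F
    using add[of E "F - E"] mono[of "F - E" F] by simp
  have empty: "\<rho> {} = 0" using add[of "{}" "{}"] by simp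
  define reg where "reg E \<longleftrightarrow> (\<forall>e>0. \<exists>K. compact K \<and> K \<subseteq> E \<and> \<rho> (E - K) < e)" for E
  \<comment> \<open>Sets that are compactly approximable from inside together with their complements form an algebra,
    on which a decreasing sequence with empty intersection has measures tending to 0.\<close>
  define \<A> where "\<A> = {E. reg E \<and> reg (- E)}"
  have cover: "\<rho> G < e" if "G \<subseteq> E \<union> F" "\<rho> E < e / 2" "\<rho> F < e / 2" for G E F e
    using mono[OF that(1)] subadd[of E F] that(2,3) by simp
  have reg_Times: "reg (A \<times> B)" if A: "A \<in> sets borel" and B: "B \<in> sets borel" for A B
    unfolding reg_def
  proof (intro allI impI)
    fix e :: real assume "0 < e"
    then have e: "0 < e / 2" by simp
    obtain K where K: "compact K" "K \<subseteq> A" "measure \<mu> (A - K) < e / 2"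
      using compact_inner_approx[OF \<mu> A e] .
    obtain L where L: "compact L" "L \<subseteq> B" "measure \<nu> (B - L) < e / 2"
      using compact_inner_approx[OF \<nu> B e] .
    have "\<rho> (A \<times> B - K \<times> L) < e"
    proof (rule cover)
      show "A \<times> B - K \<times> L \<subseteq> (A - K) \<times> UNIV \<union> UNIV \<times> (B - L)" by auto
      show "\<rho> ((A - K) \<times> UNIV) < e / 2" using K A by (subst fst) (auto simp: borel_compact)
      show "\<rho> (UNIV \<times> (B - L)) < e / 2" using L B by (subst snd) (auto simp: borel_compact)
    qed
    with K L show "\<exists>C. compact C \<and> C \<subseteq> A \<times> B \<and> \<rho> (A \<times> B - C) < e"
      by (intro exI[of _ "K \<times> L"]) (auto intro: compact_Times)
  qed
  have reg2: "\<exists>K L. compact K \<and> K \<subseteq> E \<and> \<rho> (E - K) < e / 2 \<and> compact L \<and> L \<subseteq> F \<and> \<rho> (F - L) < e / 2"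
    if "reg E" "reg F" "0 < e" for E F e
    using that unfolding reg_def by (meson half_gt_zero)
  have reg_Un: "reg (E \<union> F)" and reg_Int: "reg (E \<inter> F)" if EF: "reg E" "reg F" for E F
  proof -
    have "\<exists>K. compact K \<and> K \<subseteq> E \<union> F \<and> \<rho> (E \<union> F - K) < e"
      and "\<exists>K. compact K \<and> K \<subseteq> E \<inter> F \<and> \<rho> (E \<inter> F - K) < e" if e: "0 < e" for e
    proof -
      obtain K L where KL: "compact K" "K \<subseteq> E" "\<rho> (E - K) < e / 2" "compact L" "L \<subseteq> F" "\<rho> (F - L) < e / 2"
        using reg2[OF EF e] by blast
      have "\<rho> (E \<union> F - (K \<union> L)) < e" "\<rho> (E \<inter> F - K \<inter> L) < e"
        by (rule cover[OF _ KL(3,6)]; blast)+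
      with KL show "\<exists>K. compact K \<and> K \<subseteq> E \<union> F \<and> \<rho> (E \<union> F - K) < e"
        and "\<exists>K. compact K \<and> K \<subseteq> E \<inter> F \<and> \<rho> (E \<inter> F - K) < e"
        by (intro exI[of _ "K \<union> L"] exI[of _ "K \<inter> L"] conjI compact_Un compact_Int; blast)+
    qed
    then show "reg (E \<union> F)" "reg (E \<inter> F)" unfolding reg_def by auto
  qed
  have rect: "A \<times> B \<in> \<A>" if A: "A \<in> sets borel" and B: "B \<in> sets borel" for A B
  proof -
    have "- (A \<times> B) = (- A) \<times> UNIV \<union> UNIV \<times> (- B)" by auto
    moreover have "reg ((- A) \<times> UNIV \<union> UNIV \<times> (- B))"
      using A B by (intro reg_Un reg_Times) (auto simp: Compl_eq_Diff_UNIV)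
    ultimately show ?thesis unfolding \<A>_def using reg_Times[OF A B] by simp
  qed
  interpret algebra UNIV \<A>
    unfolding algebra_iff_Un
  proof (intro conjI ballI)
    show "{} \<in> \<A>" using rect[of "{}" "{}"] by simp
    show "UNIV - E \<in> \<A>" if "E \<in> \<A>" for E using that by (simp add: \<A>_def Compl_eq_Diff_UNIV[symmetric])
    show "E \<union> F \<in> \<A>" if "E \<in> \<A>" "F \<in> \<A>" for E F using that reg_Un reg_Int by (simp add: \<A>_def)
  qed simp
  have "\<exists>m. (\<forall>E\<in>\<A>. m E = ennreal (\<rho> E)) \<and> measure_space UNIV (sigma_sets UNIV \<A>) m"
  proof (rule caratheodory_empty_continuous)
    show "positive \<A> (\<lambda>E. ennreal (\<rho> E))" by (simp add: positive_def empty)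
    show "additive \<A> (\<lambda>E. ennreal (\<rho> E))" by (simp add: additive_def add nonneg)
    show "ennreal (\<rho> E) \<noteq> \<infinity>" for E by simp
  next
    fix A :: "nat \<Rightarrow> ('a \<times> 'b) set"
    assume A: "range A \<subseteq> \<A>" "decseq A" "(\<Inter>i. A i) = {}"
    have "(\<lambda>i. \<rho> (A i)) \<longlonglongrightarrow> 0"
    proof (rule LIMSEQ_I)
      fix e :: real assume e: "0 < e"
      have "\<exists>K. compact K \<and> K \<subseteq> A i \<and> \<rho> (A i - K) < e / 2 ^ Suc i" for i
      proof -
        have "reg (A i)" using A(1) by (auto simp: \<A>_def)
        then show ?thesis using e unfolding reg_def by simp
      qed
      then obtain K where K: "\<And>i. compact (K i)" "\<And>i. K i \<subseteq> A i" "\<And>i. \<rho> (A i - K i) < e / 2 ^ Suc i"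
        by metis
      define D where "D n = (\<Inter>i\<le>n. K i)" for n
      have D_Suc: "D (Suc n) = D n \<inter> K (Suc n)" for n
        by (auto simp: D_def atMost_Suc)
      \<comment> \<open>If no \<open>D n\<close> were empty, the finite intersection property would
        put a point into all the compact sets \<open>K i\<close>, hence into the empty intersection
        of the \<open>A i\<close>.\<close>
      obtain n where n: "D n = {}"
      proof (rule ccontr)
        assume "\<not> thesis"
        with that have ne: "D n \<noteq> {}" for n by blast
        have "K 0 \<inter> (\<Inter>i\<in>UNIV. K i) \<noteq> {}"
        proof (rule compact_imp_fip_image)
          fix I :: "nat set" assume "finite I"
          then obtain n where "I \<subseteq> {..n}" using finite_nat_iff_bounded_le by blast
          then have "D n \<subseteq> K 0 \<inter> (\<Inter>i\<in>I. K i)" by (auto simp: D_def)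
          with ne[of n] show "K 0 \<inter> (\<Inter>i\<in>I. K i) \<noteq> {}" by blast
        qed (auto intro: K(1) compact_imp_closed)
        moreover have "(\<Inter>i\<in>UNIV. K i) \<subseteq> (\<Inter>i. A i)" by (intro INF_mono' K(2))
        ultimately show False using A(3) by simp
      qed
      \<comment> \<open>Since \<open>A\<close> decreases, each new index loses only
        \<open>A (Suc n) - K (Suc n)\<close>; the bound is the partial sum of the geometric series
        of the tolerances \<open>e / 2 ^ Suc i\<close>.\<close>
      have "\<rho> (A n - D n) \<le> e * (1 - 1 / 2 ^ Suc n)" for n
      proof (induction n)
        case 0
        then show ?case using K(3)[of 0] by (simp add: D_def)
      next
        case (Suc n)
        have "A (Suc n) \<subseteq> A n" using A(2) by (simp add: decseq_Suc_iff)
        then have "\<rho> (A (Suc n) - D (Suc n)) \<le> \<rho> ((A n - D n) \<union> (A (Suc n) - K (Suc n)))"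
          by (intro mono) (auto simp: D_Suc)
        also have "\<dots> \<le> \<rho> (A n - D n) + \<rho> (A (Suc n) - K (Suc n))" by (rule subadd)
        also have "\<dots> \<le> e * (1 - 1 / 2 ^ Suc n) + e / 2 ^ Suc (Suc n)"
          using Suc K(3)[of "Suc n"] by simp
        also have "\<dots> = e * (1 - 1 / 2 ^ Suc (Suc n))" by (simp add: field_simps)
        finally show ?case .
      qed
      from this[of n] n have "\<rho> (A n) \<le> e * (1 - 1 / 2 ^ Suc n)" by simp
      also have "\<dots> < e * 1" using e by (intro mult_strict_left_mono) auto
      finally have "\<rho> (A n) < e" by simp
      moreover have "\<rho> (A m) \<le> \<rho> (A n)" if "n \<le> m" for m
        using A(2) that by (intro mono) (simp add: decseq_def)
      ultimately show "\<exists>N. \<forall>m\<ge>N. norm (\<rho> (A m) - 0) < e"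
        using nonneg by (intro exI[of _ n]) (auto intro: le_less_trans)
    qed
    then show "(\<lambda>i. ennreal (\<rho> (A i))) \<longlonglongrightarrow> 0" using tendsto_ennrealI by fastforce
  qed
  then obtain m where m: "\<And>E. E \<in> \<A> \<Longrightarrow> m E = ennreal (\<rho> E)" "measure_space UNIV (sigma_sets UNIV \<A>) m"
    by blast
  have borel_sub: "sets (borel :: ('a \<times> 'b) measure) \<subseteq> sigma_sets UNIV \<A>"
    unfolding borel_def
  proof (subst sets_measure_of)
    show "sigma_sets UNIV {S. open S} \<subseteq> sigma_sets UNIV \<A>"
    proof (rule sigma_sets_mono, safe)
      fix U :: "('a \<times> 'b) set" assume "open U"
      then obtain A B where AB: "\<And>i::nat. open (A i)" "\<And>i. open (B i)" "U = (\<Union>i. A i \<times> B i)"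
        by (rule open_prod_eq_UN_rectangles) (rule that)
      show "U \<in> sigma_sets UNIV \<A>" unfolding AB(3)
        by (intro sigma_sets.Union sigma_sets.Basic rect borel_open AB)
    qed
  qed simp
  have ms: "measure_space UNIV (sets borel) m"
    using sets.sigma_algebra_axioms[of borel]
    by (intro measure_down[OF m(2) _ borel_sub]) simp
  define \<pi> where "\<pi> = measure_of UNIV (sets borel) m"
  have sets_pi: "sets \<pi> = sets borel" unfolding \<pi>_def
    using sets.sigma_sets_eq[of borel] by (simp add: sets_measure_of)
  have em: "emeasure \<pi> E = ennreal (\<rho> E)" if "E \<in> \<A>" "E \<in> sets borel" for E
    using ms that m(1)[OF that(1)] unfolding \<pi>_def measure_space_def
    by (subst emeasure_measure_of_sigma) auto
  have closed_le: "ennreal (\<rho> C) \<le> emeasure \<pi> C" if C: "closed C" for C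
  proof -
    have "open (- C)" using C by (rule open_Compl)
    then obtain A B where AB: "\<And>i::nat. open (A i)" "\<And>i. open (B i)" "- C = (\<Union>i. A i \<times> B i)"
      by (rule open_prod_eq_UN_rectangles) (rule that)
    define D where "D n = UNIV - (\<Union>i\<le>n. A i \<times> B i)" for n
    have D\<A>: "D n \<in> \<A>" for n
      unfolding D_def using AB by (intro compl_sets finite_UN) (auto intro!: rect)
    have Db: "D n \<in> sets borel" for n
      unfolding D_def using AB by (intro borel_closed closed_Diff closed_UNIV open_UN ballI open_Times)
    have CD: "C = (\<Inter>n. D n)"
      using AB(3) by (auto simp: D_def)
    have "(\<lambda>n. emeasure \<pi> (D n)) \<longlonglongrightarrow> emeasure \<pi> (\<Inter>n. D n)"
    proof (rule Lim_emeasure_decseq)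
      show "range D \<subseteq> sets \<pi>" using Db sets_pi by auto
      show "decseq D" by (fastforce simp: decseq_def D_def)
      show "emeasure \<pi> (D n) \<noteq> \<infinity>" for n by (simp add: em D\<A> Db)
    qed
    moreover have "ennreal (\<rho> C) \<le> emeasure \<pi> (D n)" for n
      unfolding em[OF D\<A> Db] by (intro ennreal_leI mono) (use CD in blast)
    ultimately show ?thesis unfolding CD[symmetric] by (intro LIMSEQ_le_const) auto
  qed
  show ?thesis
    using that[OF sets_pi em[OF rect borel_Times] closed_le] by blast
qed

section \<open>Almost everywhere convergent minimizing sequences\<close>

lemma convergent_of_summable_increments:
  fixes f :: "nat \<Rightarrow> real"
  assumes "summable (\<lambda>n. \<bar>f (Suc n) - f n\<bar>)"
  shows "convergent f"
proof -
  have "summable (\<lambda>n. f (Suc n) - f n)" using assms by (rule summable_rabs_cancel)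
  then have "convergent (\<lambda>n. f n - f 0)"
    by (simp add: summable_iff_convergent sum_lessThan_telescope)
  then show ?thesis using convergent_diff_const_right_iff by blast
qed

text \<open>Exchanging sum and integral shows that the total variation along the sequence has finite
  integral, so it is finite almost everywhere.\<close>

lemma AE_convergent_of_summable_increments:
  fixes f :: "nat \<Rightarrow> 'a \<Rightarrow> real"
  assumes f: "\<And>n. integrable M (f n)"
    and le: "\<And>n. (\<integral>x. \<bar>f (Suc n) x - f n x\<bar> \<partial>M) \<le> b n" and b: "summable b"
  shows "AE x in M. convergent (\<lambda>n. f n x)"
proof -
  let ?d = "\<lambda>n x. \<bar>f (Suc n) x - f n x\<bar>"
  have di: "integrable M (?d n)" for n using f by simp
  have b0: "0 \<le> b n" for n using le[of n] by (rule order_trans[rotated]) simp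
  have "(\<integral>\<^sup>+x. (\<Sum>n. ennreal (?d n x)) \<partial>M) = (\<Sum>n. \<integral>\<^sup>+x. ennreal (?d n x) \<partial>M)"
    using f by (intro nn_integral_suminf) simp
  also have "\<dots> = (\<Sum>n. ennreal (\<integral>x. ?d n x \<partial>M))"
    by (intro arg_cong[where f=suminf] ext nn_integral_eq_integral di) simp
  also have "\<dots> \<le> (\<Sum>n. ennreal (b n))" using le by (intro suminf_le ennreal_leI) auto
  also have "\<dots> = ennreal (\<Sum>n. b n)" using b b0 by (intro suminf_ennreal2) auto
  finally have "(\<integral>\<^sup>+x. (\<Sum>n. ennreal (?d n x)) \<partial>M) \<noteq> \<infinity>" by (auto simp: top_unique)
  then have "AE x in M. (\<Sum>n. ennreal (?d n x)) \<noteq> \<infinity>"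
    using f by (intro nn_integral_PInf_AE) simp_all
  then show ?thesis
  proof eventually_elim
    case (elim x)
    then have "summable (\<lambda>n. ?d n x)" by (intro summable_suminf_not_top) auto
    then show ?case by (rule convergent_of_summable_increments)
  qed
qed

text \<open>This replaces a weak compactness argument. \<open>V d\<close> is the least squared norm
  among the \<open>d\<close>-minimizers of the integral; it grows to a finite limit \<open>W\<close>
  as \<open>d\<close> shrinks. Midpoints of \<open>d\<close>-minimizers are
  \<open>d\<close>-minimizers, so their squared norm cannot fall noticeably below \<open>W\<close>,
  which forces nearly norm-minimal choices to be close to each other.\<close>

lemma AE_convergent_minimizing_sequence:
  fixes \<Phi> :: "('a \<Rightarrow> real) set"
  assumes "prob_space M" and ne: "\<Phi> \<noteq> {}"
    and meas: "\<And>\<phi>. \<phi> \<in> \<Phi> \<Longrightarrow> \<phi> \<in> borel_measurable M"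
    and bound: "\<And>\<phi> x. \<phi> \<in> \<Phi> \<Longrightarrow> \<bar>\<phi> x\<bar> \<le> B"
    and mid: "\<And>\<phi> \<psi>. \<phi> \<in> \<Phi> \<Longrightarrow> \<psi> \<in> \<Phi> \<Longrightarrow> (\<lambda>x. (\<phi> x + \<psi> x) / 2) \<in> \<Phi>"
  obtains \<phi> where "\<And>n::nat. \<phi> n \<in> \<Phi>" "AE x in M. convergent (\<lambda>n. \<phi> n x)"
    "(\<lambda>n. \<integral>x. \<phi> n x \<partial>M) \<longlonglongrightarrow> (INF \<phi>\<in>\<Phi>. \<integral>x. \<phi> x \<partial>M)"
proof -
  interpret prob_space M by fact
  define I where "I \<phi> = (\<integral>x. \<phi> x \<partial>M)" for \<phi> :: "'a \<Rightarrow> real"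
  define J where "J \<phi> = (\<integral>x. (\<phi> x)\<^sup>2 \<partial>M)" for \<phi> :: "'a \<Rightarrow> real"
  define D where "D = (INF \<phi>\<in>\<Phi>. I \<phi>)"
  have int1: "integrable M \<phi>" if "\<phi> \<in> \<Phi>" for \<phi>
    using meas[OF that] bound[OF that] by (intro integrable_const_bound[of _ B]) auto
  have sq: "(\<phi> x)\<^sup>2 \<le> B\<^sup>2" if "\<phi> \<in> \<Phi>" for \<phi> x
    using bound[OF that, of x] by (rule abs_le_square_iff[THEN iffD1, OF order_trans]) simp
  have int2: "integrable M (\<lambda>x. (\<phi> x)\<^sup>2)" if "\<phi> \<in> \<Phi>" for \<phi>
    using meas[OF that] sq[OF that] by (intro integrable_const_bound[of _ "B\<^sup>2"]) auto
  have J0: "0 \<le> J \<phi>" for \<phi> unfolding J_def by simp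
  have JB: "J \<phi> \<le> B\<^sup>2" if "\<phi> \<in> \<Phi>" for \<phi>
    unfolding J_def using sq[OF that] by (intro integral_le_const int2 that) auto
  have bddI: "bdd_below (I ` \<Phi>)"
  proof (rule bdd_belowI2)
    fix \<phi> assume "\<phi> \<in> \<Phi>"
    then show "- B \<le> I \<phi>" unfolding I_def using bound[of \<phi>]
      by (intro integral_ge_const int1) (auto simp: abs_le_iff minus_le_iff)
  qed
  have D_le: "D \<le> I \<phi>" if "\<phi> \<in> \<Phi>" for \<phi> unfolding D_def using bddI that by (rule cINF_lower)
  define \<Psi> where "\<Psi> d = {\<phi> \<in> \<Phi>. I \<phi> \<le> D + d}" for d
  have \<Psi>_ne: "\<Psi> d \<noteq> {}" if "0 < d" for d
  proof -
    have "Inf (I ` \<Phi>) < D + d" using that by (simp add: D_def)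
    then obtain \<phi> where "\<phi> \<in> \<Phi>" "I \<phi> < D + d" using ne bddI by (auto simp: cInf_less_iff)
    then show ?thesis by (auto simp: \<Psi>_def less_imp_le)
  qed
  define V where "V d = (INF \<phi>\<in>\<Psi> d. J \<phi>)" for d
  have bddJ: "bdd_below (J ` \<Psi> d)" for d using J0 by (intro bdd_belowI2[of _ 0]) auto
  have V_le: "V d \<le> J \<phi>" if "\<phi> \<in> \<Psi> d" for d \<phi> unfolding V_def using bddJ that by (rule cINF_lower)
  have V_anti: "V d \<le> V e" if "0 < e" "e \<le> d" for d e
    unfolding V_def using that by (intro cINF_superset_mono \<Psi>_ne bddJ) (auto simp: \<Psi>_def)
  \<comment> \<open>By the parallelogram law, near-minimizers of \<open>J\<close> among near-minimizers of \<open>I\<close> are close in \<open>L\<^sup>2\<close>.\<close>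
  define W where "W = (SUP d\<in>{0<..}. V d)"
  have bddV: "bdd_above (V ` {0<..})"
  proof (rule bdd_aboveI2)
    fix d :: real assume "d \<in> {0<..}"
    then obtain \<phi> where "\<phi> \<in> \<Psi> d" using \<Psi>_ne[of d] by auto
    with V_le[OF this] JB[of \<phi>] show "V d \<le> B\<^sup>2" by (auto simp: \<Psi>_def)
  qed
  have V_W: "V d \<le> W" if "0 < d" for d unfolding W_def using that bddV by (intro cSUP_upper) auto
  have "\<exists>d>0. W - 1 / 4 ^ k < V d" for k :: nat
  proof -
    have "W - 1 / 4 ^ k < Sup (V ` {0<..})" by (simp add: W_def)
    then show ?thesis by (subst (asm) less_cSup_iff) (use bddV in auto)
  qed
  then obtain d where d: "\<And>k::nat. 0 < d k" "\<And>k. W - 1 / 4 ^ k < V (d k)" by metis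
  \<comment> \<open>Being decreasing puts consecutive terms into the same
    \<open>\<Psi> (e k)\<close>, staying below \<open>d k\<close> keeps \<open>V (e k)\<close>
    within \<open>1 / 4 ^ k\<close> of \<open>W\<close>, and the bound
    \<open>1 / real (Suc k)\<close> makes the integrals converge to the infimum.\<close>
  define e where "e k = min (Min (d ` {..k})) (1 / real (Suc k))" for k
  have e0: "0 < e k" for k using d(1) by (simp add: e_def)
  have e_d: "e k \<le> d k" for k unfolding e_def by (intro min.coboundedI1 Min_le) auto
  have e_Suc: "e (Suc k) \<le> e k" for k
    unfolding e_def by (intro min.mono Min_antimono) (auto simp: field_simps)
  have e_lim: "e \<longlonglongrightarrow> 0"
    by (rule real_tendsto_sandwich[OF _ _ tendsto_const LIMSEQ_inverse_real_of_nat])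
      (use e0 in \<open>auto simp: e_def less_imp_le inverse_eq_divide\<close>)
  have W_e: "W - 1 / 4 ^ k < V (e k)" for k
    using d(2)[of k] V_anti[OF e0 e_d] by (rule less_le_trans)
  have "\<exists>\<phi>\<in>\<Psi> (e k). J \<phi> < W + 1 / 4 ^ k" for k
  proof -
    have "V (e k) < W + 1 / 4 ^ k" using V_W[OF e0, of k] by (rule le_less_trans) simp
    then show ?thesis unfolding V_def
      by (subst (asm) cInf_less_iff) (use \<Psi>_ne[OF e0] bddJ in auto)
  qed
  then obtain \<phi> where \<phi>: "\<And>k. \<phi> k \<in> \<Psi> (e k)" "\<And>k. J (\<phi> k) < W + 1 / 4 ^ k" by metis
  have \<phi>\<Phi>: "\<phi> k \<in> \<Phi>" and I\<phi>: "I (\<phi> k) \<le> D + e k" for k using \<phi>(1)[of k] by (auto simp: \<Psi>_def)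
  have sqd: "(\<integral>x. (\<phi> (Suc k) x - \<phi> k x)\<^sup>2 \<partial>M) \<le> 8 / 4 ^ k"
    and isqd: "integrable M (\<lambda>x. (\<phi> (Suc k) x - \<phi> k x)\<^sup>2)" for k
  proof -
    let ?m = "\<lambda>x. (\<phi> k x + \<phi> (Suc k) x) / 2"
    have m: "?m \<in> \<Phi>" by (intro mid \<phi>\<Phi>)
    have "I ?m = (I (\<phi> k) + I (\<phi> (Suc k))) / 2"
      unfolding I_def using int1[OF \<phi>\<Phi>] by simp
    also have "\<dots> \<le> D + e k" using I\<phi>[of k] I\<phi>[of "Suc k"] e_Suc[of k] by simp
    finally have "?m \<in> \<Psi> (e k)" using m by (simp add: \<Psi>_def)
    then have Jm: "W - 1 / 4 ^ k < J ?m" using W_e[of k] V_le by (meson less_le_trans)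
    have eq: "(\<phi> (Suc k) x - \<phi> k x)\<^sup>2 = 2 * (\<phi> k x)\<^sup>2 + 2 * (\<phi> (Suc k) x)\<^sup>2 - 4 * (?m x)\<^sup>2" for x
      by (simp add: power2_eq_square field_simps)
    show "integrable M (\<lambda>x. (\<phi> (Suc k) x - \<phi> k x)\<^sup>2)" unfolding eq
      by (intro Bochner_Integration.integrable_diff Bochner_Integration.integrable_add
          integrable_mult_right int2 \<phi>\<Phi> m)
    have "(\<integral>x. (\<phi> (Suc k) x - \<phi> k x)\<^sup>2 \<partial>M) = 2 * J (\<phi> k) + 2 * J (\<phi> (Suc k)) - 4 * J ?m"
      unfolding eq J_def using int2[OF \<phi>\<Phi>] int2[OF m]
      by (subst Bochner_Integration.integral_diff Bochner_Integration.integral_add; simp)+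
    \<comment> \<open>The terms in \<open>W\<close> cancel and the errors add up to
      \<open>(2 + 1/2 + 4) / 4 ^ k\<close>.\<close>
    also have "\<dots> \<le> 8 / 4 ^ k"
      using \<phi>(2)[of k] \<phi>(2)[of "Suc k"] Jm by (simp add: field_simps)
    finally show "(\<integral>x. (\<phi> (Suc k) x - \<phi> k x)\<^sup>2 \<partial>M) \<le> 8 / 4 ^ k" .
  qed
  have "AE x in M. convergent (\<lambda>n. \<phi> n x)"
  proof (rule AE_convergent_of_summable_increments[OF int1[OF \<phi>\<Phi>]])
    show "summable (\<lambda>k. 5 * (1 / 2) ^ k :: real)" by (intro summable_mult summable_geometric) simp
    fix k
    \<comment> \<open>This weighted mean inequality turns the squared bound \<open>8 / 4 ^ k\<close>
      into the summable first-order bound \<open>(4 + 1/2) / 2 ^ k\<close>.\<close>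
    have "\<bar>t\<bar> \<le> 2 ^ k * t\<^sup>2 / 2 + (1 / 2) ^ k / 2" for t :: real
    proof -
      have "0 \<le> (2 ^ k * \<bar>t\<bar> - 1)\<^sup>2" by simp
      then show ?thesis by (simp add: power2_eq_square field_simps power_divide)
    qed
    then have "(\<integral>x. \<bar>\<phi> (Suc k) x - \<phi> k x\<bar> \<partial>M)
        \<le> (\<integral>x. 2 ^ k * (\<phi> (Suc k) x - \<phi> k x)\<^sup>2 / 2 + (1 / 2) ^ k / 2 \<partial>M)"
      using int1[OF \<phi>\<Phi>] isqd[of k] by (intro integral_mono) auto
    also have "\<dots> = 2 ^ k * (\<integral>x. (\<phi> (Suc k) x - \<phi> k x)\<^sup>2 \<partial>M) / 2 + (1 / 2) ^ k / 2"
      using isqd[of k] by (simp add: prob_space)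
    also have "\<dots> \<le> 2 ^ k * (8 / 4 ^ k) / 2 + (1 / 2) ^ k / 2"
      using sqd[of k] by (intro add_right_mono divide_right_mono mult_left_mono) auto
    also have "\<dots> \<le> 5 * (1 / 2) ^ k"
    proof -
      have "(4::real) ^ k = 2 ^ k * 2 ^ k" by (simp add: power_mult_distrib[symmetric])
      then show ?thesis by (simp add: field_simps power_divide)
    qed
    finally show "(\<integral>x. \<bar>\<phi> (Suc k) x - \<phi> k x\<bar> \<partial>M) \<le> 5 * (1 / 2) ^ k" .
  qed
  moreover have "(\<lambda>n. I (\<phi> n)) \<longlonglongrightarrow> D"
  proof (rule real_tendsto_sandwich[OF _ _ tendsto_const])
    show "(\<lambda>n. D + e n) \<longlonglongrightarrow> D" using tendsto_add[OF tendsto_const e_lim, of D] by simp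
  qed (use I\<phi> D_le \<phi>\<Phi> in auto)
  ultimately show ?thesis using that[OF \<phi>\<Phi>] by (simp add: I_def[abs_def] D_def)
qed

section \<open>Symmetric Kantorovich duality\<close>

text \<open>The sum counts the integers \<open>k < n\<close> with \<open>k \<le> w\<close>, so it
  equals the minimum of \<open>n\<close> and the floor of \<open>w\<close> plus one.\<close>

lemma staircase_bounds:
  fixes w :: real
  assumes "0 \<le> w"
  shows "min (real n) w \<le> (\<Sum>k<n. if real k \<le> w then 1 else 0)"
    and "(\<Sum>k<n. if real k \<le> w then 1 else 0) \<le> min (real n) (w + 1)"
  using assms by (induction n) (auto simp: min_def split: if_splits)

lemma usc_closed_superlevel: "usc f \<Longrightarrow> closed {p. a \<le> f p}"
  by (simp add: usc_def closed_def Compl_eq not_le)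

lemma usc_borel_measurable: "usc f \<Longrightarrow> f \<in> borel_measurable borel"
  by (rule borel_measurableI_ge) (simp add: usc_closed_superlevel)

lemma bounded_functions_subspace:
  "function_subspace {F :: 'a \<Rightarrow> real. \<exists>B. \<forall>x. \<bar>F x\<bar> \<le> B}"
proof
  fix F G :: "'a \<Rightarrow> real" and t :: real
  assume "F \<in> {F. \<exists>B. \<forall>x. \<bar>F x\<bar> \<le> B}"
  then obtain B where B: "\<And>x. \<bar>F x\<bar> \<le> B" by auto
  then have "\<forall>x. \<bar>t * F x\<bar> \<le> \<bar>t\<bar> * B" by (simp add: abs_mult mult_left_mono)
  then show "(\<lambda>x. t * F x) \<in> {F. \<exists>B. \<forall>x. \<bar>F x\<bar> \<le> B}" by blast
  assume "G \<in> {F. \<exists>B. \<forall>x. \<bar>F x\<bar> \<le> B}"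
  then obtain B' where B': "\<And>x. \<bar>G x\<bar> \<le> B'" by auto
  have "\<bar>F x + G x\<bar> \<le> B + B'" for x using B[of x] B'[of x] by linarith
  then show "(\<lambda>x. F x + G x) \<in> {F. \<exists>B. \<forall>x. \<bar>F x\<bar> \<le> B}" by blast
qed auto

lemma measure_eqI_rectangles:
  fixes M N :: "('a::second_countable_topology \<times> 'b::second_countable_topology) measure"
  assumes sets: "sets M = sets borel" "sets N = sets borel" and fin: "finite_measure M"
    and eq: "\<And>A B. A \<in> sets borel \<Longrightarrow> B \<in> sets borel \<Longrightarrow> emeasure M (A \<times> B) = emeasure N (A \<times> B)"
  shows "M = N"
proof (rule measure_eqI_generator_eq)
  let ?E = "{A \<times> B | A B. A \<in> sets (borel :: 'a measure) \<and> B \<in> sets (borel :: 'b measure)}"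
  have "sets (borel :: ('a \<times> 'b) measure) = sigma_sets UNIV ?E"
    unfolding borel_prod[symmetric] sets_pair_measure by simp
  with sets show "sets M = sigma_sets UNIV ?E" "sets N = sigma_sets UNIV ?E" by auto
  show "Int_stable ?E" by (rule Int_stable_pair_measure_generator)
  have "UNIV \<in> ?E" by (intro CollectI exI[of _ UNIV]) simp
  then show "range (\<lambda>_. UNIV) \<subseteq> ?E" by blast
  show "emeasure M UNIV \<noteq> \<infinity>" for i :: nat using fin by (simp add: finite_measure.emeasure_eq_measure)
qed (use eq in auto)

text \<open>Inner regularity by compact sets is automatic on a Polish space. Symmetry on rectangles
  supplies the second marginal and, rectangles being a generating class stable under intersection,
  invariance under the swap.\<close>

lemma Gamma_symI:
  fixes \<mu> :: "'x::polish_space measure" and \<pi> :: "('x \<times> 'x) measure"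
  assumes \<mu>: "sets \<mu> = sets borel" "prob_space \<mu>" and \<pi>: "sets \<pi> = sets borel"
    and marg: "\<And>A. A \<in> sets borel \<Longrightarrow> emeasure \<pi> (A \<times> UNIV) = emeasure \<mu> A"
    and sym: "\<And>A B. A \<in> sets borel \<Longrightarrow> B \<in> sets borel \<Longrightarrow> emeasure \<pi> (A \<times> B) = emeasure \<pi> (B \<times> A)"
  shows "\<pi> \<in> Gamma_sym \<mu>"
proof -
  have sp: "space \<pi> = UNIV" using sets_eq_imp_space_eq[OF \<pi>] by simp
  have "emeasure \<mu> UNIV = 1"
    using prob_space.emeasure_space_1[OF \<mu>(2)] sets_eq_imp_space_eq[OF \<mu>(1)] by simp
  then have "emeasure \<pi> UNIV = 1" using marg[of UNIV] by simp
  then have prob: "prob_space \<pi>" by (intro prob_spaceI) (simp add: sp)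
  interpret prob_space \<pi> by fact
  have [measurable_cong]: "sets \<pi> = sets (borel \<Otimes>\<^sub>M borel)" unfolding borel_prod by (rule \<pi>)
  have radon: "radon_prob \<pi>"
    unfolding radon_prob_def
  proof (intro conjI ballI \<pi> prob)
    fix A assume "A \<in> sets \<pi>"
    then have "emeasure \<pi> A = (SUP K\<in>{K. K \<subseteq> A \<and> compact K}. emeasure \<pi> K)"
      using \<pi> by (intro inner_regular) auto
    also have "{K. K \<subseteq> A \<and> compact K} = {K. K \<subseteq> A \<and> compact K \<and> K \<in> sets \<pi>}"
      using \<pi> borel_compact by auto
    finally show "emeasure \<pi> A = (SUP K\<in>{K. K \<subseteq> A \<and> compact K \<and> K \<in> sets \<pi>}. emeasure \<pi> K)" .
  qed
  have "distr \<pi> borel fst = \<mu>"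
  proof (rule measure_eqI)
    fix A assume "A \<in> sets (distr \<pi> borel fst)"
    then have A: "A \<in> sets borel" by simp
    have "fst -` A \<inter> space \<pi> = A \<times> UNIV" by (auto simp: sp)
    then show "emeasure (distr \<pi> borel fst) A = emeasure \<mu> A"
      using A marg by (simp add: emeasure_distr)
  qed (simp add: \<mu>)
  moreover have "distr \<pi> borel snd = \<mu>"
  proof (rule measure_eqI)
    fix A assume "A \<in> sets (distr \<pi> borel snd)"
    then have A: "A \<in> sets borel" by simp
    have "snd -` A \<inter> space \<pi> = UNIV \<times> A" by (auto simp: sp)
    then show "emeasure (distr \<pi> borel snd) A = emeasure \<mu> A"
      using A marg sym[of UNIV A] by (simp add: emeasure_distr)
  qed (simp add: \<mu>)
  moreover have "distr \<pi> borel (\<lambda>(x, z). (z, x)) = \<pi>"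
  proof (rule measure_eqI_rectangles)
    have m: "(\<lambda>(x, z). (z, x)) \<in> measurable \<pi> borel"
      unfolding borel_prod[symmetric] by measurable
    then show "finite_measure (distr \<pi> borel (\<lambda>(x, z). (z, x)))" by (rule finite_measure_distr)
    fix A B :: "'x set" assume AB: "A \<in> sets borel" "B \<in> sets borel"
    have "(\<lambda>(x, z). (z, x)) -` (A \<times> B) \<inter> space \<pi> = B \<times> A" by (auto simp: sp)
    then show "emeasure (distr \<pi> borel (\<lambda>(x, z). (z, x))) (A \<times> B) = emeasure \<pi> (A \<times> B)"
      using AB m sym[OF AB] by (simp add: emeasure_distr borel_Times)
  qed (simp_all add: \<pi>)
  ultimately show ?thesis using radon by (simp add: Gamma_sym_def)
qed

text \<open>Dominated convergence along an almost everywhere convergent minimizing sequence gives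
  the optimal value. The constraint is required at every pair of points, hence the explicit
  completion of the limit off the convergence set.\<close>

lemma dual_minimizer:
  fixes \<mu> :: "'x::polish_space measure" and f :: "'x \<times> 'x \<Rightarrow> real"
  assumes \<mu>: "sets \<mu> = sets borel" "prob_space \<mu>" and B: "\<And>p. \<bar>f p\<bar> \<le> B"
  obtains \<phi> where "\<phi> \<in> borel_measurable borel" "\<And>x. \<bar>\<phi> x\<bar> \<le> 5 * B"
    "\<And>x z. f (x, z) + f (z, x) \<le> \<phi> x + \<phi> z"
    "\<And>\<psi>. \<psi> \<in> borel_measurable borel \<Longrightarrow> integrable \<mu> \<psi> \<Longrightarrow>
       (\<And>x z. f (x, z) + f (z, x) \<le> \<psi> x + \<psi> z) \<Longrightarrow> (\<integral>x. \<phi> x \<partial>\<mu>) \<le> (\<integral>x. \<psi> x \<partial>\<mu>)"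
proof -
  interpret prob_space \<mu> by fact
  have [measurable_cong]: "sets \<mu> = sets borel" by fact
  have bm: "borel_measurable \<mu> = borel_measurable borel"
    by (intro measurable_cong_sets) (simp_all add: \<mu>)
  have B0: "0 \<le> B" using B[of undefined] by linarith
  define \<Phi> where "\<Phi> = {\<phi> \<in> borel_measurable borel.
    (\<forall>x. \<bar>\<phi> x\<bar> \<le> 3 * B) \<and> (\<forall>x z. f (x, z) + f (z, x) \<le> \<phi> x + \<phi> z)}"
  \<comment> \<open>The diagonal constraint gives \<open>- B \<le> \<psi> x\<close>. If one of the
    two values is cut to \<open>3 * B\<close>, the sum is still at least
    \<open>3 * B - B = 2 * B\<close>, which bounds the left side.\<close>
  have trunc: "(\<lambda>x. min (\<psi> x) (3 * B)) \<in> \<Phi>"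
    if \<psi>: "\<psi> \<in> borel_measurable borel" "\<And>x z. f (x, z) + f (z, x) \<le> \<psi> x + \<psi> z" for \<psi>
  proof -
    have low: "- B \<le> \<psi> x" for x using \<psi>(2)[of x x] B[of "(x, x)"] by linarith
    have "\<bar>min (\<psi> x) (3 * B)\<bar> \<le> 3 * B" for x using low[of x] B0 by (simp add: min_def abs_if)
    moreover have "f (x, z) + f (z, x) \<le> min (\<psi> x) (3 * B) + min (\<psi> z) (3 * B)" for x z
      using \<psi>(2)[of x z] low[of x] low[of z] B[of "(x, z)"] B[of "(z, x)"] by (simp add: min_def abs_le_iff)
    ultimately show ?thesis using \<psi>(1) by (simp add: \<Phi>_def)
  qed
  have ub: "f (x, z) + f (z, x) \<le> 2 * B" for x z using B[of "(x, z)"] B[of "(z, x)"] by linarith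
  have "(\<lambda>_. B) \<in> \<Phi>" using ub B0 by (simp add: \<Phi>_def)
  then have ne: "\<Phi> \<noteq> {}" by blast
  have int: "integrable \<mu> \<phi>" if "\<phi> \<in> borel_measurable borel" "\<And>x. \<bar>\<phi> x\<bar> \<le> K" for \<phi> and K :: real
    using that by (intro integrable_const_bound[of _ K]) auto
  obtain \<phi> where \<phi>: "\<And>n::nat. \<phi> n \<in> \<Phi>" and conv: "AE x in \<mu>. convergent (\<lambda>n. \<phi> n x)"
    and lim: "(\<lambda>n. \<integral>x. \<phi> n x \<partial>\<mu>) \<longlonglongrightarrow> (INF \<phi>\<in>\<Phi>. \<integral>x. \<phi> x \<partial>\<mu>)"
  proof (rule AE_convergent_minimizing_sequence[OF \<mu>(2) ne])
    show "\<phi> \<in> borel_measurable \<mu>" if "\<phi> \<in> \<Phi>" for \<phi> using that by (simp add: \<Phi>_def bm)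
    show "\<bar>\<phi> x\<bar> \<le> 3 * B" if "\<phi> \<in> \<Phi>" for \<phi> x using that by (simp add: \<Phi>_def)
    fix \<phi> \<psi> assume "\<phi> \<in> \<Phi>" "\<psi> \<in> \<Phi>"
    then have *: "\<phi> \<in> borel_measurable borel" "\<psi> \<in> borel_measurable borel"
      "\<And>x. \<bar>\<phi> x\<bar> \<le> 3 * B" "\<And>x. \<bar>\<psi> x\<bar> \<le> 3 * B"
      "\<And>x z. f (x, z) + f (z, x) \<le> \<phi> x + \<phi> z" "\<And>x z. f (x, z) + f (z, x) \<le> \<psi> x + \<psi> z"
      by (auto simp: \<Phi>_def)
    have "\<bar>(\<phi> x + \<psi> x) / 2\<bar> \<le> 3 * B" for x
      using abs_triangle_ineq[of "\<phi> x" "\<psi> x"] *(3,4)[of x] by simp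
    moreover have "f (x, z) + f (z, x) \<le> (\<phi> x + \<psi> x) / 2 + (\<phi> z + \<psi> z) / 2" for x z
      using add_mono[OF *(5,6)[of x z]] by (simp add: field_simps)
    ultimately show "(\<lambda>x. (\<phi> x + \<psi> x) / 2) \<in> \<Phi>" using *(1,2) by (simp add: \<Phi>_def)
  qed (rule that)
  have meas [measurable]: "\<phi> n \<in> borel_measurable borel" and bd: "\<bar>\<phi> n x\<bar> \<le> 3 * B"
    and dom: "f (x, z) + f (z, x) \<le> \<phi> n x + \<phi> n z" for n x z
    using \<phi>[of n] by (auto simp: \<Phi>_def)
  \<comment> \<open>The value \<open>5 * B\<close> off the set of convergence keeps the constraint valid at every point.\<close>
  define \<theta> where "\<theta> x = (if Cauchy (\<lambda>n. \<phi> n x) then lim (\<lambda>n. \<phi> n x) else 5 * B)" for x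
  have \<theta>: "\<theta> \<in> borel_measurable borel" unfolding \<theta>_def[abs_def]
    by (intro measurable_If borel_measurable_lim_metric meas borel_measurable_const)
      (use sets_Collect_Cauchy[of \<phi> borel] meas in auto)
  have lim\<theta>: "(\<lambda>n. \<phi> n x) \<longlonglongrightarrow> \<theta> x" if "Cauchy (\<lambda>n. \<phi> n x)" for x
    using that by (simp add: \<theta>_def Cauchy_convergent_iff convergent_LIMSEQ_iff)
  have lim_bd: "\<bar>\<theta> x\<bar> \<le> 3 * B" if "Cauchy (\<lambda>n. \<phi> n x)" for x
    using tendsto_rabs[OF lim\<theta>[OF that]] by (rule LIMSEQ_le_const2) (use bd in auto)
  show ?thesis
  proof (rule that[OF \<theta>])
    show "\<bar>\<theta> x\<bar> \<le> 5 * B" for x using lim_bd[of x] B0 by (cases "Cauchy (\<lambda>n. \<phi> n x)") (auto simp: \<theta>_def)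
    then have \<theta>i: "integrable \<mu> \<theta>" by (intro int[OF \<theta>])
    show "f (x, z) + f (z, x) \<le> \<theta> x + \<theta> z" for x z
    proof (cases "Cauchy (\<lambda>n. \<phi> n x)"; cases "Cauchy (\<lambda>n. \<phi> n z)")
      assume "Cauchy (\<lambda>n. \<phi> n x)" "Cauchy (\<lambda>n. \<phi> n z)"
      then have "(\<lambda>n. \<phi> n x + \<phi> n z) \<longlonglongrightarrow> \<theta> x + \<theta> z" by (intro tendsto_add lim\<theta>)
      then show ?thesis by (rule LIMSEQ_le_const) (use dom in auto)
    next
      assume "Cauchy (\<lambda>n. \<phi> n x)" "\<not> Cauchy (\<lambda>n. \<phi> n z)"
      \<comment> \<open>The default value is chosen so that \<open>- 3 * B + 5 * B = 2 * B\<close>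
        meets the bound \<open>ub\<close>.\<close>
      then show ?thesis using lim_bd[of x] ub[of x z] by (simp add: \<theta>_def[of z])
    next
      assume "\<not> Cauchy (\<lambda>n. \<phi> n x)" "Cauchy (\<lambda>n. \<phi> n z)"
      then show ?thesis using lim_bd[of z] ub[of x z] by (simp add: \<theta>_def[of x])
    next
      assume "\<not> Cauchy (\<lambda>n. \<phi> n x)" "\<not> Cauchy (\<lambda>n. \<phi> n z)"
      then show ?thesis using B0 ub[of x z] by (simp add: \<theta>_def)
    qed
    have "(\<lambda>n. \<integral>x. \<phi> n x \<partial>\<mu>) \<longlonglongrightarrow> (\<integral>x. \<theta> x \<partial>\<mu>)"
    proof (rule integral_dominated_convergence)
      show "integrable \<mu> (\<lambda>_. 3 * B)" by simp
      show "AE x in \<mu>. (\<lambda>n. \<phi> n x) \<longlonglongrightarrow> \<theta> x"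
        using conv by eventually_elim (rule lim\<theta>, simp add: Cauchy_convergent_iff)
    qed (use \<theta> bd in auto)
    with lim have \<theta>_inf: "(\<integral>x. \<theta> x \<partial>\<mu>) = (INF \<phi>\<in>\<Phi>. \<integral>x. \<phi> x \<partial>\<mu>)" by (rule LIMSEQ_unique[rotated])
    fix \<psi> assume \<psi>: "\<psi> \<in> borel_measurable borel" "integrable \<mu> \<psi>"
      "\<And>x z. f (x, z) + f (z, x) \<le> \<psi> x + \<psi> z"
    let ?\<psi> = "\<lambda>x. min (\<psi> x) (3 * B)"
    have t: "?\<psi> \<in> \<Phi>" using \<psi>(1,3) by (rule trunc)
    have "bdd_below ((\<lambda>\<phi>. \<integral>x. \<phi> x \<partial>\<mu>) ` \<Phi>)"
    proof (rule bdd_belowI2)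
      fix \<phi> assume "\<phi> \<in> \<Phi>"
      then have "\<phi> \<in> borel_measurable borel" and b: "\<And>x. \<bar>\<phi> x\<bar> \<le> 3 * B" by (auto simp: \<Phi>_def)
      then show "- (3 * B) \<le> (\<integral>x. \<phi> x \<partial>\<mu>)"
        by (intro integral_ge_const int) (auto simp: abs_le_iff minus_le_iff)
    qed
    then have "(\<integral>x. \<theta> x \<partial>\<mu>) \<le> (\<integral>x. ?\<psi> x \<partial>\<mu>)" unfolding \<theta>_inf using t by (rule cINF_lower)
    also have "\<dots> \<le> (\<integral>x. \<psi> x \<partial>\<mu>)"
    proof (rule integral_mono)
      show "integrable \<mu> ?\<psi>" using t by (intro int[of _ "3 * B"]) (auto simp: \<Phi>_def)
    qed (use \<psi> in auto)
    finally show "(\<integral>x. \<theta> x \<partial>\<mu>) \<le> (\<integral>x. \<psi> x \<partial>\<mu>)" .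
  qed
qed

text \<open>The value of a minimization problem is sublinear in its data when feasible points can be
  added and scaled along with the data.\<close>

lemma sublinear_cINF:
  fixes I :: "'b \<Rightarrow> real" and dom :: "('a \<Rightarrow> real) \<Rightarrow> 'b set"
  assumes "function_subspace S"
    and ne: "\<And>F. F \<in> S \<Longrightarrow> dom F \<noteq> {}" and bdd: "\<And>F. F \<in> S \<Longrightarrow> bdd_below (I ` dom F)"
    and add: "\<And>F G a b. F \<in> S \<Longrightarrow> G \<in> S \<Longrightarrow> a \<in> dom F \<Longrightarrow> b \<in> dom G \<Longrightarrow>
      \<exists>s\<in>dom (\<lambda>x. F x + G x). I s \<le> I a + I b"
    and scale: "\<And>F t a. F \<in> S \<Longrightarrow> 0 < t \<Longrightarrow> a \<in> dom F \<Longrightarrow>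
      \<exists>s\<in>dom (\<lambda>x. t * F x). I s \<le> t * I a"
  shows "sublinear_on S (\<lambda>F. INF a\<in>dom F. I a)"
proof -
  interpret S: function_subspace S by fact
  let ?p = "\<lambda>F. INF a\<in>dom F. I a"
  have le: "?p F \<le> I a" if "F \<in> S" "a \<in> dom F" for F a using bdd that by (intro cINF_lower)
  have hom: "?p (\<lambda>x. t * F x) \<le> t * ?p F" if F: "F \<in> S" and t: "0 < t" for F t
  proof -
    have "?p (\<lambda>x. t * F x) / t \<le> ?p F"
    proof (rule cINF_greatest[OF ne[OF F]])
      fix a assume "a \<in> dom F"
      from scale[OF F t this] obtain s where s: "s \<in> dom (\<lambda>x. t * F x)" "I s \<le> t * I a" by blast
      have "?p (\<lambda>x. t * F x) \<le> I s" by (intro le S.scale F s)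
      with s(2) t show "?p (\<lambda>x. t * F x) / t \<le> I a" by (simp add: field_simps)
    qed
    then show ?thesis using t by (simp add: field_simps)
  qed
  show ?thesis unfolding sublinear_on_def
  proof (intro conjI ballI allI impI)
    fix F and t :: real assume F: "F \<in> S" and t: "0 < t"
    have "?p (\<lambda>x. inverse t * (t * F x)) \<le> inverse t * ?p (\<lambda>x. t * F x)"
      using t by (intro hom S.scale F) auto
    then have "t * ?p F \<le> ?p (\<lambda>x. t * F x)" using t by (simp add: field_simps)
    with hom[OF F t] show "?p (\<lambda>x. t * F x) = t * ?p F" by simp
  next
    fix F G assume F: "F \<in> S" and G: "G \<in> S"
    show "?p (\<lambda>x. F x + G x) \<le> ?p F + ?p G"
    proof (rule le_cINF_add[OF ne[OF F] ne[OF G]])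
      fix a b assume "a \<in> dom F" "b \<in> dom G"
      from add[OF F G this] obtain s where s: "s \<in> dom (\<lambda>x. F x + G x)" "I s \<le> I a + I b" by blast
      have "?p (\<lambda>x. F x + G x) \<le> I s" by (intro le S.add F G s)
      with s(2) show "?p (\<lambda>x. F x + G x) \<le> I a + I b" by simp
    qed
  qed
qed

text \<open>Here \<open>p F\<close> is the dual value for every bounded cost, measurable or not, so
  that \<open>\<Lambda>\<close> can be evaluated on indicators of all sets. The proof closes the
  chain: integral of \<open>\<phi>\<close> is at most \<open>p f = \<Lambda> f\<close>, which is at
  most the integral of \<open>f\<close> against \<open>\<pi>\<close>.\<close>

lemma symmetric_kantorovich:
  fixes \<mu> :: "'x::polish_space measure" and f :: "'x \<times> 'x \<Rightarrow> real"
  assumes \<mu>: "sets \<mu> = sets borel" "prob_space \<mu>" and f: "usc f" and B: "\<And>p. \<bar>f p\<bar> \<le> B"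
  obtains \<pi> \<phi> where "\<pi> \<in> Gamma_sym \<mu>" "\<phi> \<in> borel_measurable borel" "\<And>x. \<bar>\<phi> x\<bar> \<le> 5 * B"
    "\<And>x z. f (x, z) + f (z, x) \<le> \<phi> x + \<phi> z" "(\<integral>x. \<phi> x \<partial>\<mu>) \<le> (\<integral>p. f p \<partial>\<pi>)"
proof -
  interpret prob_space \<mu> by fact
  have bm: "borel_measurable \<mu> = borel_measurable borel"
    by (intro measurable_cong_sets) (simp_all add: \<mu>)
  have B0: "0 \<le> B" using B[of undefined] by linarith
  define S where "S = {F :: 'x \<times> 'x \<Rightarrow> real. \<exists>B. \<forall>p. \<bar>F p\<bar> \<le> B}"
  have sub: "function_subspace S" unfolding S_def by (rule bounded_functions_subspace)
  interpret S: function_subspace S by (rule sub)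
  have SI: "F \<in> S" if "\<And>p. \<bar>F p\<bar> \<le> K" for F K using that by (auto simp: S_def)
  define dom where "dom F = {\<phi>. \<phi> \<in> borel_measurable borel \<and> integrable \<mu> \<phi> \<and>
    (\<forall>x z. F (x, z) + F (z, x) \<le> \<phi> x + \<phi> z)}" for F :: "'x \<times> 'x \<Rightarrow> real"
  define p where "p F = (INF \<phi>\<in>dom F. \<integral>x. \<phi> x \<partial>\<mu>)" for F
  have bdd: "bdd_below ((\<lambda>\<phi>. \<integral>x. \<phi> x \<partial>\<mu>) ` dom F)" if F: "F \<in> S" for F
  proof -
    obtain K where K: "\<And>p. \<bar>F p\<bar> \<le> K" using F by (auto simp: S_def)
    show ?thesis
    proof (rule bdd_belowI2)
      fix \<phi> assume \<phi>: "\<phi> \<in> dom F"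
      have "- K \<le> \<phi> x" for x
      proof -
        have "F (x, x) + F (x, x) \<le> \<phi> x + \<phi> x" using \<phi> unfolding dom_def by blast
        with K[of "(x, x)"] show ?thesis by linarith
      qed
      then show "- K \<le> (\<integral>x. \<phi> x \<partial>\<mu>)" using \<phi> by (intro integral_ge_const) (auto simp: dom_def)
    qed
  qed
  have ne: "dom F \<noteq> {}" if F: "F \<in> S" for F
  proof -
    obtain K where K: "\<And>p. \<bar>F p\<bar> \<le> K" using F by (auto simp: S_def)
    have "F (x, z) + F (z, x) \<le> K + K" for x z using K[of "(x, z)"] K[of "(z, x)"] by linarith
    then have "(\<lambda>_. K) \<in> dom F" by (simp add: dom_def)
    then show ?thesis by blast
  qed
  have p: "sublinear_on S p" unfolding p_def[abs_def]
  proof (rule sublinear_cINF[OF sub ne bdd])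
    fix F G \<phi> \<psi> assume "\<phi> \<in> dom F" "\<psi> \<in> dom G"
    then have *: "\<phi> \<in> borel_measurable borel" "\<psi> \<in> borel_measurable borel" "integrable \<mu> \<phi>" "integrable \<mu> \<psi>"
      "\<And>x z. F (x, z) + F (z, x) \<le> \<phi> x + \<phi> z" "\<And>x z. G (x, z) + G (z, x) \<le> \<psi> x + \<psi> z"
      by (auto simp: dom_def)
    have "F (x, z) + G (x, z) + (F (z, x) + G (z, x)) \<le> \<phi> x + \<psi> x + (\<phi> z + \<psi> z)" for x z
      using *(5,6)[of x z] by linarith
    then show "\<exists>s\<in>dom (\<lambda>x. F x + G x). (\<integral>x. s x \<partial>\<mu>) \<le> (\<integral>x. \<phi> x \<partial>\<mu>) + (\<integral>x. \<psi> x \<partial>\<mu>)"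
      using *(1-4) by (intro bexI[of _ "\<lambda>x. \<phi> x + \<psi> x"]) (auto simp: dom_def)
  next
    fix F and t :: real and \<phi> assume "0 < t" "\<phi> \<in> dom F"
    then have *: "\<phi> \<in> borel_measurable borel" "integrable \<mu> \<phi>"
      "\<And>x z. F (x, z) + F (z, x) \<le> \<phi> x + \<phi> z" by (auto simp: dom_def)
    have "t * F (x, z) + t * F (z, x) \<le> t * \<phi> x + t * \<phi> z" for x z
      using mult_left_mono[OF *(3)[of x z], of t] \<open>0 < t\<close> by (simp add: algebra_simps)
    then show "\<exists>s\<in>dom (\<lambda>x. t * F x). (\<integral>x. s x \<partial>\<mu>) \<le> t * (\<integral>x. \<phi> x \<partial>\<mu>)"
      using *(1,2) by (intro bexI[of _ "\<lambda>x. t * \<phi> x"]) (auto simp: dom_def)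
  qed
  have p_le: "p F \<le> (\<integral>x. \<phi> x \<partial>\<mu>)" if "F \<in> S" "\<phi> \<in> dom F" for F \<phi>
    unfolding p_def using bdd that by (intro cINF_lower)
  have fS: "f \<in> S" using B by (rule SI)
  obtain \<Lambda> where add: "\<And>F G. F \<in> S \<Longrightarrow> G \<in> S \<Longrightarrow> \<Lambda> (\<lambda>x. F x + G x) = \<Lambda> F + \<Lambda> G"
    and scale: "\<And>F t. F \<in> S \<Longrightarrow> \<Lambda> (\<lambda>x. t * F x) = t * \<Lambda> F"
    and le_p: "\<And>F. F \<in> S \<Longrightarrow> \<Lambda> F \<le> p F" and \<Lambda>f: "\<Lambda> f = p f"
    by (rule S.hahn_banach[OF p fS]) (rule that)
  have diff: "\<Lambda> (\<lambda>x. F x - G x) = \<Lambda> F - \<Lambda> G" if "F \<in> S" "G \<in> S" for F G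
    using add[OF that(1) S.scale[OF that(2), of "-1"]] scale[OF that(2), of "-1"] by simp
  \<comment> \<open>For such a cost the zero function is feasible. Monotonicity of
    \<open>\<Lambda>\<close> and symmetry of \<open>\<rho>\<close> both come from this.\<close>
  have \<Lambda>_le0: "\<Lambda> F \<le> 0" if F: "F \<in> S" and "\<And>x z. F (x, z) + F (z, x) \<le> 0" for F
  proof -
    have "(\<lambda>_. 0) \<in> dom F" using that by (simp add: dom_def)
    from order_trans[OF le_p[OF F] p_le[OF F this]] show ?thesis by simp
  qed
  have mono: "\<Lambda> F \<le> \<Lambda> G" if F: "F \<in> S" "G \<in> S" and "\<And>p. F p \<le> G p" for F G
  proof -
    have "F (x, z) - G (x, z) + (F (z, x) - G (z, x)) \<le> 0" for x z
      using that(3)[of "(x, z)"] that(3)[of "(z, x)"] by linarith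
    then have "\<Lambda> (\<lambda>p. F p - G p) \<le> 0"
      using S.add[OF F(1) S.minus[OF F(2)]] by (intro \<Lambda>_le0) auto
    then show ?thesis using diff[OF F] by simp
  qed
  have IS: "indicat_real E \<in> S" for E by (rule SI[of _ 1]) (simp add: indicator_def)
  define \<rho> where "\<rho> E = \<Lambda> (indicat_real E)" for E
  have \<rho>_sym: "\<rho> (A \<times> C) = \<rho> (C \<times> A)" for A C
  proof -
    have "\<rho> (A \<times> C) \<le> \<rho> (C \<times> A)" for A C
    proof -
      \<comment> \<open>The difference of the two indicators is antisymmetric, so its symmetrization
        vanishes.\<close>
      have "\<Lambda> (\<lambda>p. indicat_real (A \<times> C) p - indicat_real (C \<times> A) p) \<le> 0"
        using S.add[OF IS S.minus[OF IS], of "A \<times> C" "C \<times> A"]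
        by (intro \<Lambda>_le0) (auto simp: indicator_def)
      then show ?thesis using diff[OF IS IS, of "A \<times> C" "C \<times> A"] by (simp add: \<rho>_def)
    qed
    from this[of A C] this[of C A] show ?thesis by simp
  qed
  have \<rho>_fst: "\<rho> (A \<times> UNIV) = measure \<mu> A" if A: "A \<in> sets borel" for A
  proof (rule antisym)
    have Ai: "integrable \<mu> (indicat_real A)" "(\<integral>x. indicat_real A x \<partial>\<mu>) = measure \<mu> A"
      using A \<mu>(1) by (simp_all add: emeasure_eq_measure sets_eq_imp_space_eq[OF \<mu>(1)])
    \<comment> \<open>The constraint holds with equality, so the negated indicator is feasible for
      the negated cost as well, and the two resulting bounds meet.\<close>
    have "indicat_real A \<in> dom (indicat_real (A \<times> UNIV))"
      using A Ai(1) by (simp add: dom_def indicator_times)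
    from order_trans[OF le_p[OF IS] p_le[OF IS this]] show "\<rho> (A \<times> UNIV) \<le> measure \<mu> A"
      using Ai by (simp add: \<rho>_def)
    have "(\<lambda>x. - indicat_real A x) \<in> dom (\<lambda>p. - indicat_real (A \<times> UNIV) p)"
      using A Ai(1) by (simp add: dom_def indicator_times)
    from order_trans[OF le_p[OF S.minus[OF IS]] p_le[OF S.minus[OF IS] this]]
    show "measure \<mu> A \<le> \<rho> (A \<times> UNIV)"
      using Ai scale[OF IS, of "-1" "A \<times> UNIV"] by (simp add: \<rho>_def)
  qed
  have \<rho>0: "0 \<le> \<rho> E" for E
    using mono[OF S.zero IS, of E] scale[OF S.zero, of 0] by (simp add: \<rho>_def)
  have \<rho>_add: "\<rho> (E \<union> F) = \<rho> E + \<rho> F" if "E \<inter> F = {}" for E F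
  proof -
    have "indicat_real (E \<union> F) = (\<lambda>p. indicat_real E p + indicat_real F p)"
      by (rule ext) (use that in \<open>auto split: split_indicator\<close>)
    then show ?thesis using add[OF IS IS, of E F] by (simp add: \<rho>_def)
  qed
  have fm: "finite_measure \<mu>" by (rule finite_measure_axioms)
  obtain \<pi> where \<pi>: "sets \<pi> = sets borel"
    and rect: "\<And>A C. A \<in> sets borel \<Longrightarrow> C \<in> sets borel \<Longrightarrow> emeasure \<pi> (A \<times> C) = ennreal (\<rho> (A \<times> C))"
    and closed: "\<And>C. closed C \<Longrightarrow> ennreal (\<rho> C) \<le> emeasure \<pi> C"
    by (rule finitely_additive_extension[OF \<mu>(1) fm \<mu>(1) fm \<rho>0 \<rho>_add \<rho>_fst, unfolded \<rho>_sym[of UNIV]])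
      (use \<rho>_fst in \<open>auto intro: that\<close>)
  have \<pi>\<Gamma>: "\<pi> \<in> Gamma_sym \<mu>"
    using rect \<rho>_sym by (intro Gamma_symI \<mu> \<pi>) (simp_all add: \<rho>_fst emeasure_eq_measure)
  interpret \<pi>: prob_space \<pi> using \<pi>\<Gamma> by (simp add: Gamma_sym_def radon_prob_def)
  have sp: "space \<pi> = UNIV" using sets_eq_imp_space_eq[OF \<pi>] by simp
  have \<rho>_UNIV: "\<rho> UNIV = 1"
    using \<rho>_fst[of UNIV] prob_space sets_eq_imp_space_eq[OF \<mu>(1)] by simp
  have const: "\<Lambda> (\<lambda>_. b) = b" for b
    using scale[OF IS, of b UNIV] \<rho>_UNIV by (simp add: \<rho>_def)
  have f\<pi>: "f \<in> borel_measurable \<pi>"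
    using usc_borel_measurable[OF f] measurable_cong_sets[OF \<pi> refl] by blast
  have fi: "integrable \<pi> f" using f\<pi> B by (intro \<pi>.integrable_const_bound[of _ B]) auto
  \<comment> \<open>Approximating \<open>f + B\<close> from above by a staircase over its closed superlevel sets, on which
    the extension dominates the finitely additive functional.\<close>
  have "\<Lambda> f \<le> (\<integral>p. f p \<partial>\<pi>) + 2 * (B + 1) / real (Suc n)" for n
  proof -
    \<comment> \<open>With this mesh, \<open>Suc n\<close> steps of height \<open>h\<close> cover
      the range \<open>[0, 2 * B]\<close> of \<open>f + B\<close>; the added 1 keeps
      \<open>h\<close> positive when \<open>B = 0\<close>.\<close>
    define h where "h = 2 * (B + 1) / real (Suc n)"
    have h: "0 < h" using B0 by (simp add: h_def)
    define C where "C k = {p. real k * h - B \<le> f p}" for k :: nat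
    define s where "s m p = h * (\<Sum>k<m. indicat_real (C k) p)" for m p
    have C: "closed (C k)" for k unfolding C_def by (rule usc_closed_superlevel[OF f])
    have Cs: "C k \<in> sets \<pi>" for k using C by (simp add: \<pi>)
    have sS: "s m \<in> S" and s\<Lambda>: "\<Lambda> (s m) = h * (\<Sum>k<m. \<rho> (C k))" for m
    proof (induction m)
      case 0
      show "s 0 \<in> S" "\<Lambda> (s 0) = h * (\<Sum>k<0. \<rho> (C k))" using S.zero const[of 0] by (simp_all add: s_def[abs_def])
    next
      case (Suc m)
      have eq: "s (Suc m) = (\<lambda>p. s m p + h * indicat_real (C m) p)"
        by (simp add: s_def[abs_def] algebra_simps)
      show "s (Suc m) \<in> S" unfolding eq by (intro S.add S.scale Suc IS)
      show "\<Lambda> (s (Suc m)) = h * (\<Sum>k<Suc m. \<rho> (C k))"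
        unfolding eq using add[OF Suc(1) S.scale[OF IS]] scale[OF IS] Suc(2)
        by (simp add: \<rho>_def algebra_simps)
    qed
    let ?s = "s (Suc n)"
    have s_eq: "?s p = h * (\<Sum>k<Suc n. if real k \<le> (f p + B) / h then 1 else 0)" for p
    proof -
      have *: "p \<in> C k \<longleftrightarrow> real k \<le> (f p + B) / h" for k using h by (auto simp: C_def field_simps)
      show ?thesis unfolding s_def
        by (intro arg_cong[where f="(*) h"] sum.cong refl) (simp add: indicator_def of_bool_def *)
    qed
    have f0: "0 \<le> (f p + B) / h" for p using B[of p] h by (simp add: abs_le_iff)
    have lower: "f p + B \<le> ?s p" for p
    proof -
      have "f p + B \<le> real (Suc n) * h" using B[of p] by (simp add: h_def abs_le_iff del: of_nat_Suc)
      then have "(f p + B) / h \<le> min (real (Suc n)) ((f p + B) / h)" using h by (simp add: field_simps)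
      also note staircase_bounds(1)[OF f0[of p], of "Suc n"]
      finally show ?thesis unfolding s_eq using h by (simp only: pos_divide_le_eq mult.commute)
    qed
    have upper: "?s p \<le> f p + B + h" for p
    proof -
      have "(\<Sum>k<Suc n. if real k \<le> (f p + B) / h then 1 else 0) \<le> (f p + B) / h + 1"
        using staircase_bounds(2)[OF f0[of p], of "Suc n"] by linarith
      from mult_left_mono[OF this, of h]
      have "?s p \<le> h * ((f p + B) / h + 1)" unfolding s_eq using h by simp
      also have "\<dots> = f p + B + h" using h by (simp add: field_simps)
      finally show ?thesis .
    qed
    have \<rho>C: "\<rho> (C k) \<le> measure \<pi> (C k)" for k
      using closed[OF C, of k] by (simp add: \<pi>.emeasure_eq_measure)
    have Ii: "integrable \<pi> (indicat_real (C k))" for k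
      using Cs by (simp add: \<pi>.emeasure_eq_measure)
    have si: "integrable \<pi> ?s" unfolding s_def by (intro integrable_mult_right Bochner_Integration.integrable_sum Ii)
    have "\<Lambda> f + B = \<Lambda> (\<lambda>p. f p + B)" using add[OF fS SI[of "\<lambda>_. B" B]] const[of B] B0 by simp
    also have "\<dots> \<le> \<Lambda> ?s"
      by (intro mono sS lower S.add[OF fS SI[of "\<lambda>_. B" B]]) (use B0 in simp)
    also have "\<dots> \<le> h * (\<Sum>k<Suc n. measure \<pi> (C k))"
      unfolding s\<Lambda> using h \<rho>C by (intro mult_left_mono sum_mono) auto
    also have "\<dots> = (\<integral>p. ?s p \<partial>\<pi>)"
      unfolding s_def using Ii Cs sp by (simp add: Bochner_Integration.integral_sum del: sum.lessThan_Suc)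
    also have "\<dots> \<le> (\<integral>p. f p + B + h \<partial>\<pi>)"
      using si fi upper by (intro integral_mono) auto
    also have "\<dots> = (\<integral>p. f p \<partial>\<pi>) + B + h" using fi by (simp add: \<pi>.prob_space)
    finally show ?thesis by (simp add: h_def)
  qed
  moreover have "(\<lambda>n. (\<integral>p. f p \<partial>\<pi>) + 2 * (B + 1) / real (Suc n)) \<longlonglongrightarrow> (\<integral>p. f p \<partial>\<pi>) + 0"
    by (intro tendsto_add tendsto_const LIMSEQ_Suc[OF lim_const_over_n])
  ultimately have \<Lambda>\<pi>: "\<Lambda> f \<le> (\<integral>p. f p \<partial>\<pi>)" by (intro LIMSEQ_le_const[of _ "(\<integral>p. f p \<partial>\<pi>)"]) auto
  show ?thesis
  proof (rule dual_minimizer[OF \<mu> B])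
    fix \<phi> assume \<phi>: "\<phi> \<in> borel_measurable borel" "\<And>x. \<bar>\<phi> x\<bar> \<le> 5 * B"
      "\<And>x z. f (x, z) + f (z, x) \<le> \<phi> x + \<phi> z"
      and min: "\<And>\<psi>. \<psi> \<in> borel_measurable borel \<Longrightarrow> integrable \<mu> \<psi> \<Longrightarrow>
         (\<And>x z. f (x, z) + f (z, x) \<le> \<psi> x + \<psi> z) \<Longrightarrow> (\<integral>x. \<phi> x \<partial>\<mu>) \<le> (\<integral>x. \<psi> x \<partial>\<mu>)"
    have "(\<integral>x. \<phi> x \<partial>\<mu>) \<le> p f"
      unfolding p_def by (rule cINF_greatest[OF ne[OF fS]]) (auto simp: dom_def intro: min)
    also have "p f \<le> (\<integral>p. f p \<partial>\<pi>)" using \<Lambda>\<pi> \<Lambda>f by simp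
    finally show ?thesis by (rule that[OF \<pi>\<Gamma> \<phi>])
  qed
qed

section \<open>Selfdual Lagrangians\<close>

text \<open>\<open>P\<close> need not be measurable: images of compact sets exhaust the image measure.\<close>

lemma AE_distr_continuousD:
  fixes M :: "'a::{second_countable_topology, complete_space} measure"
    and g :: "'a \<Rightarrow> 'b::{second_countable_topology, t2_space}"
  assumes M: "sets M = sets borel" "prob_space M" and g: "continuous_on UNIV g"
    and AE: "AE p in M. P (g p)"
  shows "AE x in distr M borel g. P x"
proof -
  interpret prob_space M by fact
  have sp: "space M = UNIV" using sets_eq_imp_space_eq[OF M(1)] by simp
  have gm: "g \<in> measurable M borel"
    using borel_measurable_continuous_onI[OF g] measurable_cong_sets[OF M(1) refl] by blast
  interpret D: prob_space "distr M borel g" using gm by (rule prob_space_distr)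
  obtain N where N: "{p \<in> space M. \<not> P (g p)} \<subseteq> N" "emeasure M N = 0" "N \<in> sets M"
    using AE by (rule AE_E)
  have "\<exists>K. compact K \<and> K \<subseteq> - N \<and> measure M (- N - K) < 1 / real (Suc n)" for n
  proof -
    have "- N \<in> sets borel" using N(3) M(1) by (simp add: Compl_eq_Diff_UNIV)
    from compact_inner_approx[OF M(1) finite_measure_axioms this, of "1 / real (Suc n)"]
    show ?thesis by (metis of_nat_0_less_iff zero_less_Suc zero_less_divide_1_iff)
  qed
  then obtain K where K: "\<And>n. compact (K n)" "\<And>n. K n \<subseteq> - N"
    "\<And>n. measure M (- N - K n) < 1 / real (Suc n)" by metis
  have gK: "g ` K n \<in> sets borel" for n
    using K(1) g by (intro borel_compact compact_continuous_image continuous_on_subset[OF g]) auto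
  \<comment> \<open>A countable union of compact sets is Borel, which the image of the full
    complement of \<open>N\<close> need not be.\<close>
  define Q where "Q = (\<Union>n. g ` K n)"
  have Q: "Q \<in> sets borel" unfolding Q_def using gK by auto
  have QP: "P x" if "x \<in> Q" for x using that K(2) N(1) by (fastforce simp: Q_def sp)
  have KM: "K n \<in> sets M" for n using K(1) M(1) by (simp add: borel_compact)
  have "1 - 1 / real (Suc n) \<le> measure (distr M borel g) Q" for n
  proof -
    have "1 = measure M (- N)"
      using N(2,3) prob_compl[OF N(3)] by (simp add: sp Compl_eq_Diff_UNIV measure_def)
    also have "\<dots> = measure M (- N - K n) + measure M (K n)"
      using K(2)[of n] KM N(3) sets.compl_sets[OF N(3)]
      by (subst finite_measure_Union[symmetric])
        (auto simp: sp Compl_eq_Diff_UNIV Un_absorb2 intro!: arg_cong[where f="measure M"])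
    also have "measure M (K n) \<le> measure M (g -` Q \<inter> space M)"
      using measurable_sets[OF gm Q] by (intro finite_measure_mono) (auto simp: Q_def sp)
    also have "\<dots> = measure (distr M borel g) Q" using gm Q by (simp add: measure_distr)
    finally show ?thesis using K(3)[of n] by simp
  qed
  moreover have "(\<lambda>n. 1 - 1 / real (Suc n)) \<longlonglongrightarrow> 1 - 0"
    by (intro tendsto_diff tendsto_const LIMSEQ_Suc[OF lim_1_over_n])
  ultimately have "1 \<le> measure (distr M borel g) Q"
    using LIMSEQ_le_const2[of "\<lambda>n. 1 - 1 / real (Suc n)" 1] by simp
  then have "measure (distr M borel g) Q = 1" by (rule antisym[OF D.prob_le_1])
  then have "AE x in distr M borel g. x \<in> Q" using Q by (subst D.AE_in_set_eq_1) auto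
  then show ?thesis by eventually_elim (rule QP)
qed

text \<open>If \<open>L\<close> were constantly infinite, its conjugate would be minus infinity. One
  finite value \<open>r\<close> therefore exists; inserted into the supremum it bounds
  \<open>L\<close> below by \<open>- 2 * B - r\<close>, and inserting that bound again gives the
  upper bound \<open>4 * B + r\<close>.\<close>

lemma C_selfdual_finite:
  assumes c: "\<And>p. \<bar>c p\<bar> \<le> B" and L: "L \<in> C_selfdual c"
  obtains l where "L = (\<lambda>p. ereal (l p))"
    "\<And>x y x' y'. c (x, y') + c (x', y) \<le> l (x, y) + l (x', y')"
proof -
  let ?C = "\<lambda>x' y' x y. ereal (c (x', y) + c (x, y'))"
  have ninf: "L p \<noteq> - \<infinity>" for p using L by (cases p) (simp add: C_selfdual_def)
  have L_eq: "L (x, y) = (SUP (x', y'). ?C x' y' x y - L (x', y'))" for x y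
    using L by (auto simp: C_selfdual_def C_conj_def sym_coupling_def)
  have ge: "?C x' y' x y - L (x', y') \<le> L (x, y)" for x y x' y'
    unfolding L_eq[of x y] by (rule SUP_upper2[of "(x', y')"]) auto
  have "\<exists>p. L p \<noteq> \<infinity>"
  proof (rule ccontr)
    assume "\<nexists>p. L p \<noteq> \<infinity>"
    then have "L = (\<lambda>_. \<infinity>)" by auto
    then have "L (undefined, undefined) = - \<infinity>" using L_eq[of undefined undefined] by simp
    with ninf show False by blast
  qed
  then obtain a b where "L (a, b) \<noteq> \<infinity>" by auto
  then obtain r where r: "L (a, b) = ereal r" using ninf[of "(a, b)"] by (cases "L (a, b)") auto
  have low: "ereal (- 2 * B - r) \<le> L (x, y)" for x y
  proof -
    have "- 2 * B - r \<le> c (a, y) + c (x, b) - r" using c[of "(a, y)"] c[of "(x, b)"] by linarith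
    also have "ereal (c (a, y) + c (x, b) - r) \<le> L (x, y)" using ge[of a y x b] r by simp
    finally show ?thesis by simp
  qed
  have "L (x, y) \<le> ereal (4 * B + r)" for x y
    unfolding L_eq[of x y]
  proof (rule SUP_least, clarify)
    fix x' y'
    have "c (x', y) + c (x, y') \<le> 2 * B" using c[of "(x', y)"] c[of "(x, y')"] by linarith
    with low[of x' y'] show "?C x' y' x y - L (x', y') \<le> ereal (4 * B + r)"
      by (cases "L (x', y')") auto
  qed
  then have "L p \<noteq> \<infinity>" for p by (cases p) (metis ereal_infty_less_eq(1) PInfty_neq_ereal(1))
  with ninf have "\<exists>s. L p = ereal s" for p by (cases "L p") auto
  then obtain l where l: "\<And>p. L p = ereal (l p)" by metis
  have "c (x, y') + c (x', y) \<le> l (x, y) + l (x', y')" for x y x' y'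
    using ge[of x' y x y'] by (simp add: l)
  with l show ?thesis by (intro that[of l]) auto
qed

text \<open>After identifying \<open>(y, x)\<close> with \<open>(x, y)\<close>, the coupling becomes
  the symmetric kernel \<open>?C\<close> on pairs, and being selfdual means being self-conjugate for
  it.\<close>

lemma C_selfdual_below:
  assumes "\<And>x y x' y'. c (x, y') + c (x', y) \<le> N (x, y) + N (x', y')"
  obtains l where "\<And>p. l p \<le> N p" "(\<lambda>p. ereal (l p)) \<in> C_selfdual c"
    "\<And>x y x' y'. c (x, y') + c (x', y) \<le> l (x, y) + l (x', y')"
proof -
  let ?C = "\<lambda>p q. c (fst p, snd q) + c (fst q, snd p)"
  obtain l where l: "\<And>p. l p \<le> N p" "\<And>p q. ?C p q \<le> l p + l q"
    "\<And>p. (SUP q. ereal (?C q p) - ereal (l q)) = ereal (l p)"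
    by (rule minimal_self_conjugate[of ?C N]) (use assms in \<open>auto simp: add.commute intro: that\<close>)
  have "(\<lambda>p. ereal (l p)) \<in> C_selfdual c"
    using l(3)[of "(x, y)" for x y] by (auto simp: C_selfdual_def C_conj_def sym_coupling_def case_prod_beta)
  with l(1) show ?thesis using l(2)[of "(x, y)" "(x', y')" for x y x' y'] by (intro that[of l]) auto
qed

text \<open>Comparing \<open>(x, y)\<close> with \<open>(z, u z)\<close> in \<open>ineq\<close> and
  using \<open>eq\<close> shows that the supremum defining the Hamiltonian at \<open>(x, z)\<close>
  is attained at \<open>y = u x\<close>. At any other \<open>z'\<close> the same \<open>u x\<close>
  gives a lower bound, and subtracting yields the subdifferential inequality.\<close>

lemma hamiltonian_contact:
  assumes ineq: "\<And>x y x' y'. c (x, y') + c (x', y) \<le> l (x, y) + l (x', y')"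
    and eq: "l (x, u x) + l (z, u z) = c (x, u z) + c (z, u x)"
  shows "hamiltonian c (\<lambda>p. ereal (l p)) (x, z) = ereal (c (z, u x) - l (x, u x))"
    and "u x \<in> c_subdiff2 c (hamiltonian c (\<lambda>p. ereal (l p))) x z"
proof -
  let ?H = "hamiltonian c (\<lambda>p. ereal (l p))"
  have ge: "ereal (c (z', u x) - l (x, u x)) \<le> ?H (x, z')" for z'
    unfolding hamiltonian_def by (auto intro: SUP_upper2[of "u x"])
  have "?H (x, z) \<le> ereal (c (z, u x) - l (x, u x))"
    unfolding hamiltonian_def prod.case
  proof (rule SUP_least)
    fix y
    show "ereal (c (z, y)) - ereal (l (x, y)) \<le> ereal (c (z, u x) - l (x, u x))"
      using ineq[of x "u z" z y] eq by simp
  qed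
  with ge show H: "?H (x, z) = ereal (c (z, u x) - l (x, u x))" by (intro antisym)
  have "?H (x, z) - ?H (x, z') \<le> ereal (c (z, u x) - c (z', u x))" for z'
    using ge[of z'] by (cases "?H (x, z')") (simp_all add: H)
  then show "u x \<in> c_subdiff2 c ?H x z" by (simp add: c_subdiff2_def)
qed

section \<open>Weak duality and complementary slackness\<close>

lemma Gamma_symD:
  fixes \<mu> :: "'x::polish_space measure"
  assumes "\<pi> \<in> Gamma_sym \<mu>"
  shows "prob_space \<pi>" "sets \<pi> = sets borel"
    "distr \<pi> borel fst = \<mu>" "distr \<pi> borel snd = \<mu>" "distr \<pi> borel (\<lambda>(x, z). (z, x)) = \<pi>"
    "fst \<in> measurable \<pi> borel" "snd \<in> measurable \<pi> borel" "(\<lambda>(x, z). (z, x)) \<in> measurable \<pi> borel"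
proof -
  show s: "prob_space \<pi>" "sets \<pi> = sets borel"
    "distr \<pi> borel fst = \<mu>" "distr \<pi> borel snd = \<mu>" "distr \<pi> borel (\<lambda>(x, z). (z, x)) = \<pi>"
    using assms by (simp_all add: Gamma_sym_def radon_prob_def)
  have [measurable_cong]: "sets \<pi> = sets (borel \<Otimes>\<^sub>M borel)" unfolding borel_prod by (rule s)
  show "fst \<in> measurable \<pi> borel" "snd \<in> measurable \<pi> borel" by measurable
  show "(\<lambda>(x, z). (z, x)) \<in> measurable \<pi> borel" unfolding borel_prod[symmetric] by measurable
qed

lemma integral_Gamma_sym:
  fixes \<mu> :: "'x::polish_space measure" and f :: "'x \<times> 'x \<Rightarrow> real"
  assumes \<pi>: "\<pi> \<in> Gamma_sym \<mu>" and f: "f \<in> borel_measurable borel" "\<And>p. \<bar>f p\<bar> \<le> B"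
    and h: "integrable \<mu> h"
  defines "k \<equiv> \<lambda>(x, z). h x + h z - (f (x, z) + f (z, x))"
  shows "integrable \<pi> k" "(\<integral>p. k p \<partial>\<pi>) = 2 * ((\<integral>x. h x \<partial>\<mu>) - (\<integral>p. f p \<partial>\<pi>))"
proof -
  note G = Gamma_symD[OF \<pi>]
  interpret prob_space \<pi> by (rule G)
  have f\<pi>: "f \<in> borel_measurable \<pi>" using f(1) measurable_cong_sets[OF G(2) refl] by blast
  have fi: "integrable \<pi> f" using f\<pi> f(2) by (intro integrable_const_bound[of _ B]) auto
  have hm: "h \<in> borel_measurable borel"
    using borel_measurable_integrable[OF h] G(3) by (metis measurable_distr_eq1)
  have swap: "integrable \<pi> (\<lambda>p. f (snd p, fst p))" "(\<integral>p. f (snd p, fst p) \<partial>\<pi>) = (\<integral>p. f p \<partial>\<pi>)"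
    using integrable_distr_eq[OF G(8) f(1)] integral_distr[OF G(8) f(1)] fi
    unfolding G(5) by (simp_all add: case_prod_beta)
  have h1: "integrable \<pi> (\<lambda>p. h (fst p))" "(\<integral>p. h (fst p) \<partial>\<pi>) = (\<integral>x. h x \<partial>\<mu>)"
    using integrable_distr_eq[OF G(6) hm] integral_distr[OF G(6) hm] h unfolding G(3) by simp_all
  have h2: "integrable \<pi> (\<lambda>p. h (snd p))" "(\<integral>p. h (snd p) \<partial>\<pi>) = (\<integral>x. h x \<partial>\<mu>)"
    using integrable_distr_eq[OF G(7) hm] integral_distr[OF G(7) hm] h unfolding G(4) by simp_all
  have k: "k = (\<lambda>p. h (fst p) + h (snd p) - (f p + f (snd p, fst p)))"
    by (auto simp: k_def)
  show "integrable \<pi> k" unfolding k using fi swap(1) h1(1) h2(1) by simp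
  show "(\<integral>p. k p \<partial>\<pi>) = 2 * ((\<integral>x. h x \<partial>\<mu>) - (\<integral>p. f p \<partial>\<pi>))"
    unfolding k using fi swap h1 h2 by simp
qed

text \<open>Since \<open>l\<close> may fail to be measurable, its gap in the constraint is not
  integrated directly but squeezed between 0 and the gap of a majorant \<open>h\<close>.\<close>

lemma AE_Gamma_sym_le:
  fixes \<mu> :: "'x::polish_space measure"
  assumes \<pi>: "\<pi> \<in> Gamma_sym \<mu>" and ineq: "\<And>x z. f (x, z) + f (z, x) \<le> l x + l z"
    and h: "AE x in \<mu>. ereal (l x) \<le> ereal (h x)"
  shows "AE (x, z) in \<pi>. 0 \<le> l x + l z - (f (x, z) + f (z, x)) \<and>
    l x + l z - (f (x, z) + f (z, x)) \<le> h x + h z - (f (x, z) + f (z, x))"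
proof -
  note G = Gamma_symD[OF \<pi>]
  have "AE p in \<pi>. l (fst p) \<le> h (fst p)"
    using h unfolding G(3)[symmetric] by (auto dest: AE_distrD[OF G(6)])
  moreover have "AE p in \<pi>. l (snd p) \<le> h (snd p)"
    using h unfolding G(4)[symmetric] by (auto dest: AE_distrD[OF G(7)])
  ultimately show ?thesis
  proof eventually_elim
    case (elim p)
    then show ?case using ineq[of "fst p" "snd p"] by (cases p) simp
  qed
qed

lemma weak_duality:
  fixes \<mu> :: "'x::polish_space measure" and f :: "'x \<times> 'x \<Rightarrow> real"
  assumes \<pi>: "\<pi> \<in> Gamma_sym \<mu>" and f: "f \<in> borel_measurable borel" "\<And>p. \<bar>f p\<bar> \<le> B"
    and ineq: "\<And>x z. f (x, z) + f (z, x) \<le> l x + l z"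
  shows "ereal (\<integral>p. f p \<partial>\<pi>) \<le> upper_integral \<mu> (\<lambda>x. ereal (l x))"
  unfolding upper_integral_def
proof (rule INF_greatest)
  fix h assume h: "h \<in> {h. integrable \<mu> h \<and> (AE x in \<mu>. ereal (l x) \<le> ereal (h x))}"
  have "0 \<le> (\<integral>p. (\<lambda>(x, z). h x + h z - (f (x, z) + f (z, x))) p \<partial>\<pi>)"
    using AE_Gamma_sym_le[where f=f and l=l, OF \<pi> ineq, of h] h by (intro integral_nonneg_AE) (auto elim!: eventually_mono)
  then show "ereal (\<integral>p. f p \<partial>\<pi>) \<le> ereal (\<integral>x. h x \<partial>\<mu>)"
    using integral_Gamma_sym(2)[OF \<pi> f, of h] h by simp
qed

text \<open>Near-optimal majorants of \<open>l\<close> have gaps \<open>k n\<close> with integral at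
  most \<open>2 / real (Suc n)\<close>. A subsequence tends to 0 almost everywhere and squeezes the
  gap of \<open>l\<close>.\<close>

lemma complementary_slackness:
  fixes \<mu> :: "'x::polish_space measure" and f :: "'x \<times> 'x \<Rightarrow> real"
  assumes \<pi>: "\<pi> \<in> Gamma_sym \<mu>" and f: "f \<in> borel_measurable borel" "\<And>p. \<bar>f p\<bar> \<le> B"
    and ineq: "\<And>x z. f (x, z) + f (z, x) \<le> l x + l z"
    and opt: "upper_integral \<mu> (\<lambda>x. ereal (l x)) = ereal (\<integral>p. f p \<partial>\<pi>)"
  shows "AE (x, z) in \<pi>. l x + l z = f (x, z) + f (z, x)"
proof -
  have "\<exists>h. integrable \<mu> h \<and> (AE x in \<mu>. ereal (l x) \<le> ereal (h x)) \<and>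
      (\<integral>x. h x \<partial>\<mu>) < (\<integral>p. f p \<partial>\<pi>) + 1 / real (Suc n)" for n
  proof -
    have "upper_integral \<mu> (\<lambda>x. ereal (l x)) < ereal ((\<integral>p. f p \<partial>\<pi>) + 1 / real (Suc n))"
      unfolding opt by simp
    then show ?thesis unfolding upper_integral_def INF_less_iff by auto
  qed
  then obtain h where h: "\<And>n. integrable \<mu> (h n)" "\<And>n. AE x in \<mu>. ereal (l x) \<le> ereal (h n x)"
    "\<And>n. (\<integral>x. h n x \<partial>\<mu>) < (\<integral>p. f p \<partial>\<pi>) + 1 / real (Suc n)" by metis
  define k where "k n = (\<lambda>(x, z). h n x + h n z - (f (x, z) + f (z, x)))" for n
  have ki: "integrable \<pi> (k n)" and kI: "(\<integral>p. k n p \<partial>\<pi>) = 2 * ((\<integral>x. h n x \<partial>\<mu>) - (\<integral>p. f p \<partial>\<pi>))" for n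
    unfolding k_def by (rule integral_Gamma_sym[OF \<pi> f h(1)])+
  have gap: "AE (x, z) in \<pi>. 0 \<le> l x + l z - (f (x, z) + f (z, x)) \<and>
      l x + l z - (f (x, z) + f (z, x)) \<le> k n (x, z)" for n
    using AE_Gamma_sym_le[where f=f and l=l, OF \<pi> ineq h(2)] by (simp add: k_def)
  have "(\<lambda>n. \<integral>p. norm (k n p) \<partial>\<pi>) \<longlonglongrightarrow> 0"
  proof (rule real_tendsto_sandwich[OF _ _ tendsto_const])
    show "\<forall>\<^sub>F n in sequentially. 0 \<le> (\<integral>p. norm (k n p) \<partial>\<pi>)" by simp
    have "(\<integral>p. norm (k n p) \<partial>\<pi>) \<le> 2 / real (Suc n)" for n
    proof -
      have "(\<integral>p. norm (k n p) \<partial>\<pi>) = (\<integral>p. k n p \<partial>\<pi>)"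
        using gap[of n] ki by (intro integral_cong_AE) (auto elim!: eventually_mono)
      also have "\<dots> \<le> 2 / real (Suc n)" unfolding kI using h(3)[of n] by simp
      finally show ?thesis .
    qed
    then show "\<forall>\<^sub>F n in sequentially. (\<integral>p. norm (k n p) \<partial>\<pi>) \<le> 2 / real (Suc n)" by simp
    show "(\<lambda>n. 2 / real (Suc n)) \<longlonglongrightarrow> 0" by (intro LIMSEQ_Suc[OF lim_const_over_n])
  qed
  from tendsto_L1_AE_subseq[OF ki this] obtain r where "AE p in \<pi>. (\<lambda>n. k (r n) p) \<longlonglongrightarrow> 0" by blast
  moreover have "AE p in \<pi>. \<forall>n. case p of (x, z) \<Rightarrow> 0 \<le> l x + l z - (f (x, z) + f (z, x)) \<and>
      l x + l z - (f (x, z) + f (z, x)) \<le> k n (x, z)"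
    using gap by (simp add: AE_all_countable)
  ultimately show ?thesis
  proof eventually_elim
    case (elim p)
    obtain x z where p: "p = (x, z)" by (cases p)
    have "l x + l z - (f (x, z) + f (z, x)) \<le> 0"
      using elim(1) by (rule LIMSEQ_le_const) (use elim(2) p in auto)
    with elim(2) p show ?case by auto
  qed
qed

section \<open>Attainment, optimality conditions and the monotone case\<close>

theorem theorem5p1:
  fixes \<mu> :: "'x::polish_space measure"
    and c :: "'x \<times> 'y::polish_space \<Rightarrow> real"
    and u :: "'x \<Rightarrow> 'y"
  assumes "sets \<mu> = sets borel" and "prob_space \<mu>" and "nonatomic \<mu>"
    and "c \<in> borel_measurable borel" and "bounded (range c)"
    and "usc (\<lambda>(x, z). c (x, u z))"
  shows
    "(MK_sym \<mu> c u = DK_sym \<mu> c u \<and>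
      (\<exists>\<pi>\<in>Gamma_sym \<mu>. ereal (\<integral>(x, z). c (x, u z) \<partial>\<pi>) = MK_sym \<mu> c u) \<and>
      (\<exists>L\<in>C_selfdual c. upper_integral \<mu> (\<lambda>x. L (x, u x)) = DK_sym \<mu> c u))
   \<and> (\<forall>\<pi>\<^sub>0\<in>Gamma_sym \<mu>. \<forall>L\<in>C_selfdual c.
        ereal (\<integral>(x, z). c (x, u z) \<partial>\<pi>\<^sub>0) = MK_sym \<mu> c u \<longrightarrow>
        upper_integral \<mu> (\<lambda>x. L (x, u x)) = DK_sym \<mu> c u \<longrightarrow>
        (AE (x, z) in \<pi>\<^sub>0. u x \<in> c_subdiff2 c (hamiltonian c L) x z) \<and>
        (\<forall>S. (AE (x, z) in \<pi>\<^sub>0. z = S x) \<longrightarrow>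
           (AE x in \<mu>. S (S x) = x \<and>
              hamiltonian c L (x, S x) = - hamiltonian c L (S x, x) \<and>
              u x \<in> c_subdiff2 c (hamiltonian c L) x (S x))))
   \<and> (c_monotone c u \<longrightarrow>
        (\<exists>L\<in>C_selfdual c.
           (AE x in \<mu>. hamiltonian c L (x, x) = 0) \<and>
           (AE x in \<mu>. u x \<in> c_subdiff2 c (hamiltonian c L) x x)))"
proof -
  define f where "f = (\<lambda>(x, z). c (x, u z))"
  obtain B where B: "\<And>p. \<bar>c p\<bar> \<le> B" using assms(5) by (auto simp: bounded_iff)
  then have fB: "\<bar>f p\<bar> \<le> B" for p by (simp add: f_def case_prod_beta)
  have B0: "0 \<le> B" using B[of undefined] by linarith
  have f: "usc f" unfolding f_def by (rule assms(6))
  then have fm: "f \<in> borel_measurable borel" by (rule usc_borel_measurable)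
  have f_sum: "f (x, z) + f (z, x) = c (x, u z) + c (z, u x)" for x z by (simp add: f_def)
  have weak: "ereal (\<integral>p. f p \<partial>\<pi>) \<le> upper_integral \<mu> (\<lambda>x. L (x, u x))"
    if "\<pi> \<in> Gamma_sym \<mu>" "L \<in> C_selfdual c" for \<pi> L
  proof (rule C_selfdual_finite[OF B that(2)])
    fix l assume L: "L = (\<lambda>p. ereal (l p))"
      and ineq: "\<And>x y x' y'. c (x, y') + c (x', y) \<le> l (x, y) + l (x', y')"
    show ?thesis unfolding L
      by (rule weak_duality[OF that(1) fm fB]) (use ineq f_sum in simp)
  qed
  have MK: "MK_sym \<mu> c u = (SUP \<pi>\<in>Gamma_sym \<mu>. ereal (\<integral>p. f p \<partial>\<pi>))"
    by (simp add: MK_sym_def f_def)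
  have part1: "MK_sym \<mu> c u = DK_sym \<mu> c u \<and>
      (\<exists>\<pi>\<in>Gamma_sym \<mu>. ereal (\<integral>p. f p \<partial>\<pi>) = MK_sym \<mu> c u) \<and>
      (\<exists>L\<in>C_selfdual c. upper_integral \<mu> (\<lambda>x. L (x, u x)) = DK_sym \<mu> c u)"
  proof (rule symmetric_kantorovich[OF assms(1,2) f fB])
    fix \<pi> \<phi> assume \<pi>: "\<pi> \<in> Gamma_sym \<mu>" and \<phi>: "\<phi> \<in> borel_measurable borel" "\<And>x. \<bar>\<phi> x\<bar> \<le> 5 * B"
      and dual: "\<And>x z. f (x, z) + f (z, x) \<le> \<phi> x + \<phi> z" and gap: "(\<integral>x. \<phi> x \<partial>\<mu>) \<le> (\<integral>p. f p \<partial>\<pi>)"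
    interpret prob_space \<mu> by (rule assms(2))
    have \<phi>i: "integrable \<mu> \<phi>"
      using \<phi> measurable_cong_sets[OF assms(1) refl, of "borel :: real measure"]
      by (intro integrable_const_bound[of _ "5 * B"]) auto
    \<comment> \<open>On the graph of \<open>u\<close> the constraint is the dual one for
      \<open>\<phi>\<close>. Off it, \<open>7 * B - 5 * B = 2 * B\<close> bounds the coupling,
      because \<open>\<phi> \<ge> - 5 * B\<close>.\<close>
    define N where "N = (\<lambda>(x, y). if y = u x then \<phi> x else 7 * B)"
    have N: "c (x, y') + c (x', y) \<le> N (x, y) + N (x', y')" for x y x' y'
      using dual[of x x'] B[of "(x, y')"] B[of "(x', y)"] \<phi>(2)[of x] \<phi>(2)[of x'] B0 f_sum[of x x']
      by (auto simp: N_def)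
    show ?thesis
    proof (rule C_selfdual_below[of c N, OF N])
      fix l assume l: "\<And>p. l p \<le> N p" and sd: "(\<lambda>p. ereal (l p)) \<in> C_selfdual c"
      have "upper_integral \<mu> (\<lambda>x. ereal (l (x, u x))) \<le> ereal (\<integral>x. \<phi> x \<partial>\<mu>)"
        unfolding upper_integral_def
      proof (rule INF_lower)
        have "l (x, u x) \<le> \<phi> x" for x using l[of "(x, u x)"] by (simp add: N_def)
        then show "\<phi> \<in> {h. integrable \<mu> h \<and> (AE x in \<mu>. ereal (l (x, u x)) \<le> ereal (h x))}"
          using \<phi>i by simp
      qed
      with gap have up: "upper_integral \<mu> (\<lambda>x. ereal (l (x, u x))) \<le> ereal (\<integral>p. f p \<partial>\<pi>)"
        by (meson ereal_less_eq(3) order_trans)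
      have "DK_sym \<mu> c u \<le> upper_integral \<mu> (\<lambda>x. ereal (l (x, u x)))"
        unfolding DK_sym_def using sd by (rule INF_lower)
      moreover have "ereal (\<integral>p. f p \<partial>\<pi>) \<le> MK_sym \<mu> c u"
        unfolding MK using \<pi> by (rule SUP_upper)
      moreover have "MK_sym \<mu> c u \<le> DK_sym \<mu> c u"
        unfolding MK DK_sym_def by (intro SUP_least INF_greatest weak)
      \<comment> \<open>Together with \<open>up\<close> the inequalities form a cycle, so all four
        quantities coincide.\<close>
      ultimately have "MK_sym \<mu> c u = DK_sym \<mu> c u" "ereal (\<integral>p. f p \<partial>\<pi>) = MK_sym \<mu> c u"
        "upper_integral \<mu> (\<lambda>x. ereal (l (x, u x))) = DK_sym \<mu> c u"
        using up by order+
      with \<pi> sd show ?thesis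
        by (intro conjI bexI[of _ \<pi>] bexI[of _ "\<lambda>p. ereal (l p)"]) simp_all
    qed
  qed
  have part2: "(AE (x, z) in \<pi>. u x \<in> c_subdiff2 c (hamiltonian c L) x z) \<and>
      (\<forall>S. (AE (x, z) in \<pi>. z = S x) \<longrightarrow>
        (AE x in \<mu>. S (S x) = x \<and> hamiltonian c L (x, S x) = - hamiltonian c L (S x, x) \<and>
          u x \<in> c_subdiff2 c (hamiltonian c L) x (S x)))"
    if \<pi>: "\<pi> \<in> Gamma_sym \<mu>" and L: "L \<in> C_selfdual c"
      and \<pi>_opt: "ereal (\<integral>p. f p \<partial>\<pi>) = MK_sym \<mu> c u"
      and L_opt: "upper_integral \<mu> (\<lambda>x. L (x, u x)) = DK_sym \<mu> c u" for \<pi> L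
  proof (rule C_selfdual_finite[OF B L])
    fix l assume Ll: "L = (\<lambda>p. ereal (l p))"
      and ineq: "\<And>x y x' y'. c (x, y') + c (x', y) \<le> l (x, y) + l (x', y')"
    note G = Gamma_symD[OF \<pi>]
    have "AE (x, z) in \<pi>. l (x, u x) + l (z, u z) = f (x, z) + f (z, x)"
    proof (rule complementary_slackness[OF \<pi> fm fB])
      show "f (x, z) + f (z, x) \<le> l (x, u x) + l (z, u z)" for x z using ineq f_sum by simp
      show "upper_integral \<mu> (\<lambda>x. ereal (l (x, u x))) = ereal (\<integral>p. f p \<partial>\<pi>)"
        using L_opt \<pi>_opt part1 by (simp add: Ll)
    qed
    then have slack: "AE (x, z) in \<pi>. l (x, u x) + l (z, u z) = c (x, u z) + c (z, u x)"
      by (simp add: f_sum)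
    have sub: "AE (x, z) in \<pi>. u x \<in> c_subdiff2 c (hamiltonian c L) x z"
      using slack
    proof eventually_elim
      case (elim p)
      then show ?case
        using hamiltonian_contact(2)[where c=c and l=l and u=u and x="fst p" and z="snd p", OF ineq]
        by (simp add: Ll case_prod_beta)
    qed
    \<comment> \<open>The slackness equation is symmetric in \<open>x\<close> and \<open>z\<close>,
      so the contact formula applies in both orders and the two Hamiltonian values add up to
      zero.\<close>
    have anti: "AE (x, z) in \<pi>. hamiltonian c L (x, z) = - hamiltonian c L (z, x)"
      using slack
    proof eventually_elim
      case (elim p)
      then show ?case
        using hamiltonian_contact(1)[where c=c and l=l and u=u and x="fst p" and z="snd p", OF ineq]
          hamiltonian_contact(1)[where c=c and l=l and u=u and x="snd p" and z="fst p", OF ineq]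
        by (simp add: Ll case_prod_beta add.commute)
    qed
    have "AE x in \<mu>. S (S x) = x \<and> hamiltonian c L (x, S x) = - hamiltonian c L (S x, x) \<and>
        u x \<in> c_subdiff2 c (hamiltonian c L) x (S x)" if S: "AE (x, z) in \<pi>. z = S x" for S
    proof -
      \<comment> \<open>Swap invariance turns \<open>z = S x\<close> into \<open>x = S z\<close>,
        which gives the involution property.\<close>
      have "AE p in distr \<pi> borel (\<lambda>(x, z). (z, x)). snd p = S (fst p)"
        unfolding G(5) using S by (simp add: case_prod_beta)
      from AE_distrD[OF G(8) this] have S': "AE p in \<pi>. fst p = S (snd p)"
        by (simp add: case_prod_beta)
      have "AE p in \<pi>. S (S (fst p)) = fst p \<and>
          hamiltonian c L (fst p, S (fst p)) = - hamiltonian c L (S (fst p), fst p) \<and>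
          u (fst p) \<in> c_subdiff2 c (hamiltonian c L) (fst p) (S (fst p))"
        using S S' sub anti by eventually_elim (auto simp: case_prod_beta)
      \<comment> \<open>The property involves the arbitrary maps \<open>u\<close> and
        \<open>S\<close> and may be non-measurable, so it is carried to the first marginal by
        compact exhaustion.\<close>
      from AE_distr_continuousD[OF G(2,1) continuous_on_fst[OF continuous_on_id] this]
      show ?thesis unfolding G(3) .
    qed
    with sub show ?thesis by blast
  qed
  have part3: "\<exists>L\<in>C_selfdual c. (AE x in \<mu>. hamiltonian c L (x, x) = 0) \<and>
      (AE x in \<mu>. u x \<in> c_subdiff2 c (hamiltonian c L) x x)" if u: "c_monotone c u"
  proof -
    \<comment> \<open>On the graph of \<open>u\<close> the constraint is exactly
      \<open>c\<close>-monotonicity; off it, \<open>3 * B - B = 2 * B\<close> suffices.\<close>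
    define N where "N = (\<lambda>(x, y). if y = u x then c (x, u x) else 3 * B)"
    have N: "c (x, y') + c (x', y) \<le> N (x, y) + N (x', y')" for x y x' y'
      using u[unfolded c_monotone_def, rule_format, of x x'] B[of "(x, y')"] B[of "(x', y)"]
        B[of "(x, u x)"] B[of "(x', u x')"] B0
      by (auto simp: N_def abs_le_iff)
    show ?thesis
    proof (rule C_selfdual_below[of c N, OF N])
      fix l assume l: "\<And>p. l p \<le> N p" and sd: "(\<lambda>p. ereal (l p)) \<in> C_selfdual c"
        and ineq: "\<And>x y x' y'. c (x, y') + c (x', y) \<le> l (x, y) + l (x', y')"
      \<comment> \<open>The diagonal case of \<open>ineq\<close> supplies the lower bound, so
        contact holds at every \<open>(x, x)\<close> with Hamiltonian value 0.\<close>
      have l_eq: "l (x, u x) = c (x, u x)" for x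
        using l[of "(x, u x)"] ineq[of x "u x" x "u x"] by (simp add: N_def)
      have "hamiltonian c (\<lambda>p. ereal (l p)) (x, x) = 0"
        and "u x \<in> c_subdiff2 c (hamiltonian c (\<lambda>p. ereal (l p))) x x" for x
        using hamiltonian_contact[where c=c and l=l and u=u and x=x and z=x, OF ineq]
        by (simp_all add: l_eq zero_ereal_def)
      with sd show ?thesis by (intro bexI) auto
    qed
  qed
  show ?thesis
    by (rule conjI[OF part1[unfolded f_def]], rule conjI, intro ballI impI,
        rule part2[unfolded f_def], assumption+, rule impI, rule part3, assumption)
qed

end
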